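(* Let $\mu$ be a probability measure on $(\mathbb{N},2^{\mathbb{N}})$, where $\mathbb{N}=\{1,2,\dots\}$, with $\mu(\{k\})=p_k>0$ for all $k\geqslant1$. Suppose that $\mathbb{N}\setminus\{1\}$ is partitioned into $n$ infinite subsets $A_1,\dots,A_n$. Let $\mathcal{A}_i=\sigma a(A_i)$, $i=1,\dots,n$, be the corresponding $\sigma$-algebras. Set $r_k:=\sum_{j=k}^\infty p_j$, $k\geqslant1$. Consider the following statements: (1) the collection $\mathcal{A}_1,\dots,\mathcal{A}_n$ possesses the IMP; (2) the system of subspaces $L^2_0(\mathcal{A}_1),\dots,L^2_0(\mathcal{A}_n)$ possesses the IBAP; (3) the subspace $L^2_0(\mathcal{A}_1)+\dots+L^2_0(\mathcal{A}_n)$ is closed in $L^2(2^{\mathbb{N}})$; (4) $L^2_0(\mathcal{A}_1)+\dots+L^2_0(\mathcal{A}_n)=L^2_0(2^{\mathbb{N}})$; (5) $\sup\{r_{k+1}/r_k\mid k\geqslant1\}<1$. Then statements (1), (2), (3), (4) are pairwise equivalent and (5) implies (1). If there exists a number $k_0\geqslant2$ such that for every $k\geqslant k_0$ the numbers $k$ and $k+1$ belong to distinct sets $A_i$, then (1) implies (5).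
   Context: For an infinite subset $A=\{k_1,k_2,k_3,\dots\}$ of $\mathbb{N}\setminus\{1\}$, $2\leqslant k_1<k_2<k_3<\dots$, let $part(A)$ be the partition $\{\{1,\dots,k_1-1\},\{k_1,\dots,k_2-1\},\{k_2,\dots,k_3-1\},\dots\}$ of $\mathbb{N}$, and let $\sigma a(A)$ be the $\sigma$-algebra generated by $part(A)$. Random variables take values in a fixed base field $\mathbb{K}$, $\mathbb{K}=\mathbb{R}$ or $\mathbb{C}$; $E$ denotes expectation. For a probability space $(\Omega,\mathcal{F},\mu)$, $L^2(\mathcal{F})$ is the Hilbert space of (equivalence classes of) random variables $\xi$ with $E|\xi|^2<\infty$ and inner product $\langle\xi,\eta\rangle=E(\xi\overline{\eta})$. For a sub-$\sigma$-algebra $\mathcal{A}$ of $\mathcal{F}$, $L^2(\mathcal{A})$ is the closed subspace of $L^2(\mathcal{F})$ of classes containing at least one $\mathcal{A}$-measurable random variable, and $L^2_0(\mathcal{A}):=\{\xi\in L^2(\mathcal{A})\mid E\xi=0\}$. Here $\Omega=\mathbb{N}$, $\mathcal{F}=2^{\mathbb{N}}$. A collection $\mathcal{F}_1,\dots,\mathcal{F}_n$ of sub-$\sigma$-algebras possesses the inverse marginal property (IMP) if for arbitrary random variables $\xi_1,\dots,\xi_n$ such that $\xi_k$ is $\mathcal{F}_k$-measurable and $E|\xi_k|^2<\infty$ for $k=1,\dots,n$, and $E\xi_1=\dots=E\xi_n$, there exists a random variable $\xi$ with $E|\xi|^2<\infty$ and $E(\xi|\mathcal{F}_k)=\xi_k$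 for all $k=1,\dots,n$. A system of closed subspaces $H_1,\dots,H_n$ of a Hilbert space $H$, with $P_k$ the orthogonal projection onto $H_k$, possesses the inverse best approximation property (IBAP) if for arbitrary $x_1\in H_1,\dots,x_n\in H_n$ there exists $x\in H$ such that $P_kx=x_k$ for all $k=1,\dots,n$. In (2) the ambient Hilbert space is $L^2(2^{\mathbb{N}})$. *)

theory Defs
  imports "HOL-Probability.Probability"
begin

text \<open>
  The base field is a set \<open>K\<close> of complex numbers, either \<open>\<real>\<close> or all of \<open>\<complex>\<close>; a random variable
  with values in the base field is a complex-valued measurable function whose values lie in \<open>K\<close>.

  Elements of \<open>L\<^sup>2\<close> are handled through their representatives: every set of vectors below is a set
  of functions that is saturated under almost sure equality (and under changes outside
  \<open>space M\<close>), so that equality, sums and closedness of such sets are equality, sums and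
  closedness of the corresponding sets of equivalence classes.
\<close>

definition random_vars :: "complex set \<Rightarrow> 'a measure \<Rightarrow> ('a \<Rightarrow> complex) set" where
  "random_vars K M = {\<xi> \<in> borel_measurable M. \<forall>\<omega>\<in>space M. \<xi> \<omega> \<in> K}"

definition L2 :: "complex set \<Rightarrow> 'a measure \<Rightarrow> 'a measure \<Rightarrow> ('a \<Rightarrow> complex) set" where
  "L2 K M G = {\<xi> \<in> random_vars K M. integrable M (\<lambda>\<omega>. (cmod (\<xi> \<omega>))\<^sup>2) \<and>
     (\<exists>\<eta>\<in>random_vars K G. AE \<omega> in M. \<xi> \<omega> = \<eta> \<omega>)}"

definition L2_0 :: "complex set \<Rightarrow> 'a measure \<Rightarrow> 'a measure \<Rightarrow> ('a \<Rightarrow> complex) set" where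
  "L2_0 K M G = {\<xi> \<in> L2 K M G. (\<integral>\<omega>. \<xi> \<omega> \<partial>M) = 0}"

definition L2_inner :: "'a measure \<Rightarrow> ('a \<Rightarrow> complex) \<Rightarrow> ('a \<Rightarrow> complex) \<Rightarrow> complex" where
  "L2_inner M \<xi> \<eta> = (\<integral>\<omega>. \<xi> \<omega> * cnj (\<eta> \<omega>) \<partial>M)"

definition L2_norm :: "'a measure \<Rightarrow> ('a \<Rightarrow> complex) \<Rightarrow> real" where
  "L2_norm M \<xi> = sqrt (\<integral>\<omega>. (cmod (\<xi> \<omega>))\<^sup>2 \<partial>M)"

definition closed_in_L2 :: "complex set \<Rightarrow> 'a measure \<Rightarrow> ('a \<Rightarrow> complex) set \<Rightarrow> bool" where
  "closed_in_L2 K M S \<longleftrightarrow>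
     S \<subseteq> L2 K M M \<and>
     (\<forall>f g. (\<forall>j::nat. f j \<in> S) \<and> g \<in> L2 K M M \<and>
            (\<lambda>j. L2_norm M (\<lambda>\<omega>. f j \<omega> - g \<omega>)) \<longlonglongrightarrow> 0 \<longrightarrow> g \<in> S)"

definition sum_of_subspaces :: "nat \<Rightarrow> (nat \<Rightarrow> ('a \<Rightarrow> complex) set) \<Rightarrow> ('a \<Rightarrow> complex) set" where
  "sum_of_subspaces n H = {\<lambda>\<omega>. \<Sum>k=1..n. x k \<omega> | x. \<forall>k\<in>{1..n}. x k \<in> H k}"

text \<open>
  \<open>is_orth_proj ip V x y\<close>: the vector \<open>y\<close> is (a representative of) the orthogonal projection of
  \<open>x\<close> onto the subspace \<open>V\<close>.
\<close>

definition is_orth_proj :: "('v::minus \<Rightarrow> 'v \<Rightarrow> complex) \<Rightarrow> 'v set \<Rightarrow> 'v \<Rightarrow> 'v \<Rightarrow> bool" where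
  "is_orth_proj ip V x y \<longleftrightarrow> y \<in> V \<and> (\<forall>v\<in>V. ip (x - y) v = 0)"

definition IBAP ::
  "'v::minus set \<Rightarrow> ('v \<Rightarrow> 'v \<Rightarrow> complex) \<Rightarrow> nat \<Rightarrow> (nat \<Rightarrow> 'v set) \<Rightarrow> bool" where
  "IBAP H ip n V \<longleftrightarrow>
     (\<forall>x. (\<forall>k\<in>{1..n}. x k \<in> V k) \<longrightarrow> (\<exists>y\<in>H. \<forall>k\<in>{1..n}. is_orth_proj ip (V k) y (x k)))"

text \<open>
  The library's conditional expectation is for real random variables; the complex one is taken
  componentwise.
\<close>

definition complex_cond_exp :: "'a measure \<Rightarrow> 'a measure \<Rightarrow> ('a \<Rightarrow> complex) \<Rightarrow> 'a \<Rightarrow> complex" where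
  "complex_cond_exp M G \<xi> \<omega> =
     Complex (real_cond_exp M G (\<lambda>\<omega>. Re (\<xi> \<omega>)) \<omega>) (real_cond_exp M G (\<lambda>\<omega>. Im (\<xi> \<omega>)) \<omega>)"

definition IMP :: "complex set \<Rightarrow> 'a measure \<Rightarrow> nat \<Rightarrow> (nat \<Rightarrow> 'a measure) \<Rightarrow> bool" where
  "IMP K M n F \<longleftrightarrow>
     (\<forall>\<xi>. (\<forall>k\<in>{1..n}. \<xi> k \<in> random_vars K (F k) \<and> integrable M (\<lambda>\<omega>. (cmod (\<xi> k \<omega>))\<^sup>2)) \<and>
          (\<forall>i\<in>{1..n}. \<forall>j\<in>{1..n}. (\<integral>\<omega>. \<xi> i \<omega> \<partial>M) = (\<integral>\<omega>. \<xi> j \<omega> \<partial>M)) \<longrightarrow>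
          (\<exists>\<zeta>\<in>random_vars K M. integrable M (\<lambda>\<omega>. (cmod (\<zeta> \<omega>))\<^sup>2) \<and>
             (\<forall>k\<in>{1..n}. AE \<omega> in M. complex_cond_exp M (F k) \<zeta> \<omega> = \<xi> k \<omega>)))"

text \<open>The numbers \<open>k\<^sub>1 < k\<^sub>2 < \<dots>\<close> are \<open>enumerate A 0 < enumerate A 1 < \<dots>\<close>.\<close>

definition part :: "nat set \<Rightarrow> nat set set" where
  "part A = insert {1..<enumerate A 0} (range (\<lambda>j. {enumerate A j..<enumerate A (Suc j)}))"

definition sigma_a :: "nat set \<Rightarrow> nat measure" where
  "sigma_a A = sigma {1..} (part A)"

end

theory Submission
  imports Defs
begin

text \<open>
  Write \<open>x k\<close> for the value of a function at the point \<open>k + 1\<close> and \<open>w k\<close> for the mass of that point, so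
  that \<open>L\<^sup>2\<close> becomes a weighted sequence space. A function is measurable with respect to \<open>sigma_a (A i)\<close>
  exactly if it jumps (\<open>x k \<noteq> x (k - 1)\<close>) only at points of \<open>A i\<close>. Since the sets \<open>A i\<close> partition the
  possible jump points, every function is, up to constants, in exactly one way a sum of such functions:
  the summand for \<open>i\<close> is its jump part, which keeps the jumps at points of \<open>A i\<close> and drops the others.
  So the sum of the subspaces is all of \<open>L\<^sup>2\<^sub>0\<close> if and only if every jump part maps \<open>L\<^sup>2\<close> into itself.

  Prescribing the conditional expectations of \<open>\<zeta>\<close>, or its projections, amounts to prescribing its mean
  and the tails \<open>t k = (\<Sum>j\<ge>k. w j * \<zeta> j)\<close>, those with \<open>k + 1 \<in> A i\<close> by the data for \<open>i\<close>. Together these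
  are all tails, so \<open>\<zeta> k = (t k - t (k + 1)) / w k\<close> is forced, and the only question is whether this
  sequence is square summable. Summation by parts shows that the formula is the adjoint of the jump
  part. The IMP and the IBAP thus say that the adjoints map mean zero functions of the respective
  subspaces into \<open>L\<^sup>2\<close>.

  A linear operator of this kind that is defined everywhere is bounded
  (\<open>everywhere_defined_operator_bounded\<close>), and boundedness passes between an operator and its adjoint
  (\<open>jump_adjoint_ell2\<close>, \<open>jump_part_ell2_of_adjoint\<close>); this makes the IMP, the IBAP and the
  equality of the sum with \<open>L\<^sup>2\<^sub>0\<close> equivalent. A closed sum is all of \<open>L\<^sup>2\<^sub>0\<close> because functions that
  are constant from some point on have square summable jump parts and are dense.

  If the tails of \<open>w\<close> decay geometrically, they are comparable to \<open>w\<close>, and a recursive estimate of Hardy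
  type bounds the jump parts (\<open>jump_part_ell2_of_geometric_tails\<close>). Conversely, if neighbouring points
  lie in different sets, the jump part of the indicator of one point is the indicator of the tail
  starting there, so that boundedness compares the tail with the single mass
  (\<open>tail_ratio_of_jump_part_bounded\<close>).
\<close>

section \<open>Weighted square summable sequences\<close>

locale positive_weights =
  fixes w :: "nat \<Rightarrow> real"
  assumes w_pos: "0 < w k" and w_sums: "w sums 1"
begin

definition ell2 :: "(nat \<Rightarrow> real) set" where
  "ell2 = {x. summable (\<lambda>k. w k * (x k)\<^sup>2)}"

text \<open>
  The absolute value has no effect on square summable sequences; it keeps the value nonnegative on all
  others, where the infinite sum is an unspecified number.
\<close>

definition nrm :: "(nat \<Rightarrow> real) \<Rightarrow> real" where
  "nrm x = sqrt \<bar>\<Sum>k. w k * (x k)\<^sup>2\<bar>"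

lemma w_nonneg: "0 \<le> w k" using w_pos[of k] by simp
lemma w_summable: "summable w" using w_sums by (rule sums_summable)

lemma w_sq_nonneg: "0 \<le> w k * a\<^sup>2"
  by (simp add: w_nonneg)

lemma nrm_nonneg: "0 \<le> nrm x"
  by (simp add: nrm_def)

lemma nrm_sq: "x \<in> ell2 \<Longrightarrow> (nrm x)\<^sup>2 = (\<Sum>k. w k * (x k)\<^sup>2)"
  unfolding nrm_def ell2_def by (simp add: suminf_nonneg w_sq_nonneg)

lemma sum_le_nrm_sq: "x \<in> ell2 \<Longrightarrow> finite I \<Longrightarrow> (\<Sum>k\<in>I. w k * (x k)\<^sup>2) \<le> (nrm x)\<^sup>2"
  by (simp add: nrm_sq ell2_def sum_le_suminf w_sq_nonneg)

lemma ell2_of_bounded_sums: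
  assumes "\<And>N. (\<Sum>k<N. w k * (x k)\<^sup>2) \<le> c\<^sup>2" "0 \<le> c"
  shows "x \<in> ell2" "nrm x \<le> c"
proof -
  show "x \<in> ell2" unfolding ell2_def
    using summableI_nonneg_bounded[of "\<lambda>k. w k * (x k)\<^sup>2", OF w_sq_nonneg assms(1)] by simp
  then have "(nrm x)\<^sup>2 \<le> c\<^sup>2"
    using suminf_le_const[of "\<lambda>k. w k * (x k)\<^sup>2", OF _ assms(1)] by (simp add: nrm_sq ell2_def)
  then show "nrm x \<le> c" using assms(2) by (rule power2_le_imp_le)
qed

lemma ell2_mult:
  assumes "x \<in> ell2" "y \<in> ell2"
  shows "summable (\<lambda>k. \<bar>w k * x k * y k\<bar>)" "summable (\<lambda>k. w k * x k * y k)"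
    "(\<Sum>k. \<bar>w k * x k * y k\<bar>) \<le> nrm x * nrm y" "\<bar>\<Sum>k. w k * x k * y k\<bar> \<le> nrm x * nrm y"
proof -
  have le: "(\<Sum>k<N. \<bar>w k * x k * y k\<bar>) \<le> nrm x * nrm y" for N
  proof -
    have "(\<Sum>k<N. \<bar>w k * x k * y k\<bar>) = (\<Sum>k<N. \<bar>sqrt (w k) * x k\<bar> * \<bar>sqrt (w k) * y k\<bar>)"
    proof (rule sum.cong[OF refl])
      fix k
      have "\<bar>w k * x k * y k\<bar> = (sqrt (w k) * sqrt (w k)) * (\<bar>x k\<bar> * \<bar>y k\<bar>)"
        by (simp add: w_nonneg abs_mult)
      also have "\<dots> = \<bar>sqrt (w k) * x k\<bar> * \<bar>sqrt (w k) * y k\<bar>"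
        unfolding abs_mult abs_of_nonneg[OF real_sqrt_ge_zero[OF w_nonneg]] by (simp only: ac_simps)
      finally show "\<bar>w k * x k * y k\<bar> = \<bar>sqrt (w k) * x k\<bar> * \<bar>sqrt (w k) * y k\<bar>" .
    qed
    also have "\<dots> \<le> L2_set (\<lambda>k. sqrt (w k) * x k) {..<N} * L2_set (\<lambda>k. sqrt (w k) * y k) {..<N}"
      by (rule L2_set_mult_ineq)
    also have "\<dots> \<le> nrm x * nrm y"
    proof -
      have "L2_set (\<lambda>k. sqrt (w k) * z k) {..<N} \<le> nrm z" if "z \<in> ell2" for z
        unfolding L2_set_def
        by (rule real_le_lsqrt)
          (use sum_le_nrm_sq[OF that, of "{..<N}"] in \<open>simp_all add: nrm_nonneg power_mult_distrib w_nonneg sum_nonneg\<close>)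
      then show ?thesis using assms by (intro mult_mono) (auto simp: nrm_nonneg)
    qed
    finally show ?thesis .
  qed
  show s: "summable (\<lambda>k. \<bar>w k * x k * y k\<bar>)"
    by (rule summableI_nonneg_bounded[OF _ le]) simp
  then show "summable (\<lambda>k. w k * x k * y k)" by (rule summable_rabs_cancel)
  show m: "(\<Sum>k. \<bar>w k * x k * y k\<bar>) \<le> nrm x * nrm y"
    by (rule suminf_le_const[OF s le])
  show "\<bar>\<Sum>k. w k * x k * y k\<bar> \<le> nrm x * nrm y"
    using summable_rabs[OF s] m by linarith
qed

lemma ell2_scale: assumes "x \<in> ell2"
  shows "(\<lambda>k. a * x k) \<in> ell2" "nrm (\<lambda>k. a * x k) = \<bar>a\<bar> * nrm x"
proof -
  have e: "w k * (a * x k)\<^sup>2 = a\<^sup>2 * (w k * (x k)\<^sup>2)" for k by (simp add: power_mult_distrib)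
  show "(\<lambda>k. a * x k) \<in> ell2" using assms by (simp add: ell2_def e summable_mult)
  show "nrm (\<lambda>k. a * x k) = \<bar>a\<bar> * nrm x"
    unfolding nrm_def e using assms by (simp add: ell2_def suminf_mult real_sqrt_mult abs_mult)
qed

lemma ell2_add: assumes "x \<in> ell2" "y \<in> ell2"
  shows "(\<lambda>k. x k + y k) \<in> ell2" "nrm (\<lambda>k. x k + y k) \<le> nrm x + nrm y"
proof -
  have e: "w k * (x k + y k)\<^sup>2 = w k * (x k)\<^sup>2 + 2 * (w k * x k * y k) + w k * (y k)\<^sup>2" for k
    by (simp add: power2_eq_square algebra_simps)
  have sx: "summable (\<lambda>k. w k * (x k)\<^sup>2)" "summable (\<lambda>k. w k * (y k)\<^sup>2)"
    using assms by (auto simp: ell2_def)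
  note s = ell2_mult(2)[OF assms]
  show m: "(\<lambda>k. x k + y k) \<in> ell2" using sx s
    by (auto simp: ell2_def e intro!: summable_add summable_mult)
  have "(nrm (\<lambda>k. x k + y k))\<^sup>2 = (nrm x)\<^sup>2 + 2 * (\<Sum>k. w k * x k * y k) + (nrm y)\<^sup>2"
  proof -
    have "(\<lambda>k. w k * (x k)\<^sup>2 + 2 * (w k * x k * y k) + w k * (y k)\<^sup>2) sums
        ((nrm x)\<^sup>2 + 2 * (\<Sum>k. w k * x k * y k) + (nrm y)\<^sup>2)"
      unfolding nrm_sq[OF assms(1)] nrm_sq[OF assms(2)]
      by (intro sums_add sums_mult summable_sums sx s)
    then show ?thesis unfolding nrm_sq[OF m] by (simp add: e sums_iff)
  qed
  also have "\<dots> \<le> (nrm x)\<^sup>2 + 2 * (nrm x * nrm y) + (nrm y)\<^sup>2"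
    using ell2_mult(4)[OF assms] by linarith
  also have "\<dots> = (nrm x + nrm y)\<^sup>2" by (simp add: power2_eq_square algebra_simps)
  finally show "nrm (\<lambda>k. x k + y k) \<le> nrm x + nrm y"
    by (rule power2_le_imp_le) (simp add: nrm_nonneg)
qed

lemma ell2_lincomb: assumes "x \<in> ell2" "y \<in> ell2" shows "(\<lambda>k. a * x k + b * y k) \<in> ell2"
proof (rule ell2_add(1))
  show "(\<lambda>k. a * x k) \<in> ell2" by (rule ell2_scale(1)[OF assms(1)])
  show "(\<lambda>k. b * y k) \<in> ell2" by (rule ell2_scale(1)[OF assms(2)])
qed

lemma ell2_diff: assumes "x \<in> ell2" "y \<in> ell2"
  shows "(\<lambda>k. x k - y k) \<in> ell2" "nrm (\<lambda>k. x k - y k) \<le> nrm x + nrm y"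
proof -
  have y: "(\<lambda>k. - y k) \<in> ell2" "nrm (\<lambda>k. - y k) = nrm y"
    using assms(2) by (simp_all add: ell2_def nrm_def)
  have e: "(\<lambda>k. x k - y k) = (\<lambda>k. x k + (- y k))" by simp
  show "(\<lambda>k. x k - y k) \<in> ell2" unfolding e by (rule ell2_add(1)[OF assms(1) y(1)])
  show "nrm (\<lambda>k. x k - y k) \<le> nrm x + nrm y"
    using ell2_add(2)[OF assms(1) y(1)] unfolding y(2) e .
qed

lemma coordinate_le_nrm: assumes "x \<in> ell2" shows "\<bar>x k\<bar> \<le> nrm x / sqrt (w k)"
proof -
  have "(sqrt (w k) * \<bar>x k\<bar>)\<^sup>2 \<le> (nrm x)\<^sup>2"
    using sum_le_nrm_sq[OF assms, of "{k}"] by (simp add: power_mult_distrib w_nonneg)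
  then have "sqrt (w k) * \<bar>x k\<bar> \<le> nrm x" by (rule power2_le_imp_le) (rule nrm_nonneg)
  then show ?thesis using w_pos[of k] by (simp add: field_simps)
qed

lemma ell2_bounded: assumes "\<And>k. \<bar>x k\<bar> \<le> c" shows "x \<in> ell2" "nrm x \<le> c"
proof -
  have c: "0 \<le> c" using assms[of 0] by linarith
  have "(\<Sum>k<N. w k * (x k)\<^sup>2) \<le> c\<^sup>2" for N
  proof -
    have "(\<Sum>k<N. w k * (x k)\<^sup>2) \<le> (\<Sum>k<N. w k * c\<^sup>2)"
      using assms by (intro sum_mono mult_left_mono w_nonneg) (simp add: abs_le_square_iff[symmetric] c)
    also have "\<dots> = (\<Sum>k<N. w k) * c\<^sup>2" by (simp add: sum_distrib_right)
    also have "\<dots> \<le> 1 * c\<^sup>2" using sum_le_suminf[OF w_summable, of "{..<N}"] w_sums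
      by (intro mult_right_mono) (auto simp: sums_iff w_nonneg)
    finally show ?thesis by simp
  qed
  from ell2_of_bounded_sums[OF this c] show "x \<in> ell2" "nrm x \<le> c" by auto
qed

lemma ell2_const: "(\<lambda>_. c) \<in> ell2" using ell2_bounded(1)[of "\<lambda>_. c" "\<bar>c\<bar>"] by simp

lemma ell2_summable_abs: assumes "x \<in> ell2"
  shows "summable (\<lambda>k. \<bar>w k * x k\<bar>)" "(\<Sum>k. \<bar>w k * x k\<bar>) \<le> nrm x"
proof -
  have n1: "nrm (\<lambda>_. 1) \<le> 1" by (rule ell2_bounded) simp
  show "summable (\<lambda>k. \<bar>w k * x k\<bar>)" using ell2_mult(1)[OF assms ell2_const[of 1]] by simp
  have "(\<Sum>k. \<bar>w k * x k\<bar>) \<le> nrm x * nrm (\<lambda>_. 1)"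
    using ell2_mult(3)[OF assms ell2_const[of 1]] by simp
  also have "\<dots> \<le> nrm x" using n1 nrm_nonneg[of x] by (simp add: mult_left_le)
  finally show "(\<Sum>k. \<bar>w k * x k\<bar>) \<le> nrm x" .
qed

lemma ell2_summable: "x \<in> ell2 \<Longrightarrow> summable (\<lambda>k. w k * x k)"
  by (rule summable_rabs_cancel[OF ell2_summable_abs(1)])

text \<open>
  Pointwise limits stand in for completeness: a bound on the norms survives because every finite
  partial sum is continuous under pointwise convergence.
\<close>

lemma ell2_Fatou:
  assumes X: "\<And>m. X m \<in> ell2" "\<And>m. nrm (X m) \<le> c" and lim: "\<And>k. (\<lambda>m. X m k) \<longlonglongrightarrow> x k"
  shows "x \<in> ell2" "nrm x \<le> c"
proof -
  have c: "0 \<le> c" using X(2)[of 0] nrm_nonneg[of "X 0"] by linarith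
  have "(\<Sum>k<N. w k * (x k)\<^sup>2) \<le> c\<^sup>2" for N
  proof (rule LIMSEQ_le_const2)
    show "(\<lambda>m. \<Sum>k<N. w k * (X m k)\<^sup>2) \<longlonglongrightarrow> (\<Sum>k<N. w k * (x k)\<^sup>2)"
      by (intro tendsto_intros lim)
    have "(\<Sum>k<N. w k * (X m k)\<^sup>2) \<le> c\<^sup>2" for m
      using sum_le_nrm_sq[OF X(1), of "{..<N}" m] power_mono[OF X(2) nrm_nonneg, of m 2] by auto
    then show "\<exists>M. \<forall>m\<ge>M. (\<Sum>k<N. w k * (X m k)\<^sup>2) \<le> c\<^sup>2" by blast
  qed
  from ell2_of_bounded_sums[OF this c] show "x \<in> ell2" "nrm x \<le> c" by auto
qed

section \<open>Everywhere defined operators are bounded\<close>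

definition partial_nrm :: "nat \<Rightarrow> (nat \<Rightarrow> real) \<Rightarrow> real" where
  "partial_nrm N x = L2_set (\<lambda>k. sqrt (w k) * x k) {..<N}"

lemma partial_nrm_sq: "(partial_nrm N x)\<^sup>2 = (\<Sum>k<N. w k * (x k)\<^sup>2)"
  unfolding partial_nrm_def L2_set_def
  by (simp add: power_mult_distrib w_nonneg sum_nonneg)

lemma partial_nrm_nonneg: "0 \<le> partial_nrm N x"
  by (simp add: partial_nrm_def)

lemma partial_nrm_le: "x \<in> ell2 \<Longrightarrow> partial_nrm N x \<le> nrm x"
  by (rule power2_le_imp_le) (auto simp: partial_nrm_sq nrm_nonneg sum_le_nrm_sq)

lemma partial_nrm_add: "partial_nrm N (\<lambda>k. x k + y k) \<le> partial_nrm N x + partial_nrm N y"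
  unfolding partial_nrm_def distrib_left by (rule L2_set_triangle_ineq)

lemma partial_nrm_scale: "partial_nrm N (\<lambda>k. a * x k) = \<bar>a\<bar> * partial_nrm N x"
proof -
  have "(partial_nrm N (\<lambda>k. a * x k))\<^sup>2 = (\<bar>a\<bar> * partial_nrm N x)\<^sup>2"
    by (simp add: partial_nrm_sq power_mult_distrib sum_distrib_left mult.left_commute)
  then show ?thesis by (simp add: partial_nrm_nonneg)
qed

text \<open>
  The closed graph theorem for operators with continuous coordinates, by a gliding hump. The truncated
  norms \<open>T N x\<close> of \<open>L x\<close> are continuous seminorms that stay bounded at each \<open>x\<close>; suppose that their
  operator norms \<open>\<tau> N\<close> do not. Add multiples of size \<open>3 ^ (- m)\<close> of vectors \<open>u m\<close> that nearly attain the
  norm of \<open>T (n m)\<close>, choosing at each step the sign that does not decrease \<open>T (n m)\<close>. All later summands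
  together are too small to cancel this gain, so \<open>T (n m)\<close> is large at the limit, for every \<open>m\<close>.
\<close>

lemma everywhere_defined_operator_bounded:
  fixes L :: "(nat \<Rightarrow> real) \<Rightarrow> nat \<Rightarrow> real" and V :: "(nat \<Rightarrow> real) set"
  assumes V: "V \<subseteq> ell2" "V \<noteq> {}"
    and V_lin: "\<And>x y a b. x \<in> V \<Longrightarrow> y \<in> V \<Longrightarrow> (\<lambda>k. a * x k + b * y k) \<in> V"
    and V_closed: "\<And>X x. (\<And>m. X m \<in> V) \<Longrightarrow> x \<in> ell2 \<Longrightarrow>
        (\<lambda>m. nrm (\<lambda>k. X m k - x k)) \<longlonglongrightarrow> 0 \<Longrightarrow> x \<in> V"
    and L_lin: "\<And>x y a b k. x \<in> V \<Longrightarrow> y \<in> V \<Longrightarrow>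
        L (\<lambda>k. a * x k + b * y k) k = a * L x k + b * L y k"
    and L_cont: "\<And>k. \<exists>c. \<forall>x\<in>V. \<bar>L x k\<bar> \<le> c * nrm x"
    and L_into: "\<And>x. x \<in> V \<Longrightarrow> L x \<in> ell2"
  shows "\<exists>C\<ge>0. \<forall>x\<in>V. nrm (L x) \<le> C * nrm x"
proof -
  define T where "T N x = partial_nrm N (L x)" for N x
  have T0: "0 \<le> T N x" for N x by (simp add: T_def partial_nrm_nonneg)
  have T_lin: "T N (\<lambda>k. a * x k + b * y k) \<le> \<bar>a\<bar> * T N x + \<bar>b\<bar> * T N y"
    if "x \<in> V" "y \<in> V" for N a b x y
  proof -
    have "L (\<lambda>k. a * x k + b * y k) = (\<lambda>k. a * L x k + b * L y k)"
      using L_lin[OF that] by auto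
    then show ?thesis unfolding T_def
      using partial_nrm_add[of N "\<lambda>k. a * L x k" "\<lambda>k. b * L y k"] by (simp add: partial_nrm_scale)
  qed
  have T_scale: "T N (\<lambda>k. a * x k) \<le> \<bar>a\<bar> * T N x" if "x \<in> V" for N a x
    using T_lin[OF that that, of N a 0] by simp
  have V_scale: "(\<lambda>k. a * x k) \<in> V" if "x \<in> V" for a x
    using V_lin[OF that that, of a 0] by simp
  have zero: "(\<lambda>_. 0) \<in> V" using V(2) V_scale[of _ 0] by auto
  define ball where "ball = {x \<in> V. nrm x \<le> 1}"
  have nrm0: "nrm (\<lambda>_. 0) = 0" by (simp add: nrm_def)
  have zball: "(\<lambda>_. 0) \<in> ball" using zero by (simp add: ball_def nrm0)
  have bdd: "bdd_above (T N ` ball)" for N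
  proof -
    have "\<forall>k. \<exists>c. \<forall>x\<in>V. \<bar>L x k\<bar> \<le> c * nrm x" using L_cont by blast
    from choice[OF this] obtain c where c: "\<And>k x. x \<in> V \<Longrightarrow> \<bar>L x k\<bar> \<le> c k * nrm x" by blast
    have "T N x \<le> (\<Sum>k<N. sqrt (w k) * \<bar>c k\<bar>)" if "x \<in> ball" for x
    proof -
      have "T N x \<le> (\<Sum>k<N. \<bar>sqrt (w k) * L x k\<bar>)"
        unfolding T_def partial_nrm_def by (rule L2_set_le_sum_abs)
      also have "\<dots> \<le> (\<Sum>k<N. sqrt (w k) * \<bar>c k\<bar>)"
      proof (rule sum_mono)
        fix k
        have "\<bar>L x k\<bar> \<le> c k * nrm x" using c that by (auto simp: ball_def)
        also have "\<dots> \<le> \<bar>c k\<bar> * 1" using that by (intro mult_mono) (auto simp: nrm_nonneg ball_def)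
        finally show "\<bar>sqrt (w k) * L x k\<bar> \<le> sqrt (w k) * \<bar>c k\<bar>"
          by (simp add: abs_mult w_nonneg mult_left_mono)
      qed
      finally show ?thesis .
    qed
    then show ?thesis by (intro bdd_aboveI2)
  qed
  define \<tau> where "\<tau> N = (SUP x\<in>ball. T N x)" for N
  have T_ball: "T N x \<le> \<tau> N" if "x \<in> ball" for N x
    unfolding \<tau>_def using that by (rule cSUP_upper[OF _ bdd])
  have \<tau>0: "0 \<le> \<tau> N" for N using T_ball[OF zball, of N] T0[of N "\<lambda>_. 0"] by linarith
  have T_le: "T N x \<le> \<tau> N * nrm x" if "x \<in> V" for N x
  proof (cases "nrm x = 0")
    case True
    have "x k = 0" for k using coordinate_le_nrm[of x k] that V True by auto
    then have "x = (\<lambda>k. 0 * x k)" by auto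
    then have "T N x \<le> 0" using T_scale[OF that, of N 0] by simp
    then show ?thesis using True by simp
  next
    case False
    then have pos: "nrm x > 0" using nrm_nonneg[of x] by simp
    define y where "y = (\<lambda>k. (1 / nrm x) * x k)"
    have "y \<in> V" unfolding y_def by (rule V_scale[OF that])
    moreover have "nrm y = 1" unfolding y_def using ell2_scale(2)[of x "1 / nrm x"] V that pos by auto
    ultimately have "y \<in> ball" by (simp add: ball_def)
    then have "T N y \<le> \<tau> N" by (rule T_ball)
    have "x = (\<lambda>k. nrm x * y k)" using pos by (auto simp: y_def)
    then have "T N x \<le> nrm x * T N y"
      using T_scale[of y N "nrm x"] \<open>y \<in> ball\<close> pos by (simp add: ball_def)
    also have "\<dots> \<le> nrm x * \<tau> N" using \<open>T N y \<le> \<tau> N\<close> pos by simp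
    finally show ?thesis by (simp add: mult.commute)
  qed
  have near: "\<exists>u\<in>ball. 3 / 4 * \<tau> N \<le> T N u" for N
  proof (cases "\<tau> N = 0")
    case True then show ?thesis using zball T0 by auto
  next
    case False
    then have "3 / 4 * \<tau> N < \<tau> N" using \<tau>0[of N] by simp
    then obtain u where "u \<in> ball" "3 / 4 * \<tau> N < T N u"
      unfolding \<tau>_def using less_cSUP_iff[OF _ bdd[of N]] zball by blast
    then show ?thesis by force
  qed
  have "\<exists>C. \<forall>N. \<tau> N \<le> C"
  proof (rule ccontr)
    assume "\<nexists>C. \<forall>N. \<tau> N \<le> C"
    then have "\<forall>m::nat. \<exists>N. 4 * 3 ^ m * real m \<le> \<tau> N" by (meson linear)
    from choice[OF this] obtain n where n: "\<And>m. 4 * 3 ^ m * real m \<le> \<tau> (n m)" by blast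
    have "\<forall>m. \<exists>v. v \<in> ball \<and> 3 / 4 * \<tau> (n m) \<le> T (n m) v" using near by blast
    from choice[OF this] obtain u where u: "\<And>m. u m \<in> ball" "\<And>m. 3 / 4 * \<tau> (n m) \<le> T (n m) (u m)" by blast
    have uV: "u m \<in> V" "nrm (u m) \<le> 1" for m using u(1)[of m] by (auto simp: ball_def)
    define e where "e m = (1 / 3 :: real) ^ m" for m
    have e0: "0 < e m" for m by (simp add: e_def)
    define step where "step m x y \<longleftrightarrow> (\<exists>s. \<bar>s\<bar> = e m \<and> y = (\<lambda>k. 1 * x k + s * u m k)) \<and>
      e m * T (n m) (u m) \<le> T (n m) y" for m x y
    have "\<exists>X. \<forall>m. X m \<in> V \<and> (m = 0 \<longrightarrow> X m = (\<lambda>_. 0)) \<and> step m (X m) (X (Suc m))"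
    proof -
      have "\<exists>X. \<forall>m. (X m \<in> V \<and> (m = 0 \<longrightarrow> X m = (\<lambda>_. 0))) \<and> step m (X m) (X (Suc m))"
      proof (rule dependent_nat_choice)
        show "\<exists>x. x \<in> V \<and> ((0::nat) = 0 \<longrightarrow> x = (\<lambda>_. 0))" using zero by blast
        fix x and m :: nat assume x: "x \<in> V \<and> (m = 0 \<longrightarrow> x = (\<lambda>_. 0))"
        \<comment> \<open>The vector \<open>2 * e m * u m\<close> is the difference of the two candidates, so one of them has
          at least the required seminorm.\<close>
        define y z where "y = (\<lambda>k. 1 * x k + e m * u m k)" and "z = (\<lambda>k. 1 * x k + (- e m) * u m k)"
        have yz: "y \<in> V" "z \<in> V" unfolding y_def z_def using V_lin x uV(1) by blast+
        have "u m = (\<lambda>k. (1 / (2 * e m)) * y k + (- 1 / (2 * e m)) * z k)"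
          using e0[of m] by (auto simp: y_def z_def field_simps)
        then have "T (n m) (u m) \<le> (1 / (2 * e m)) * T (n m) y + (1 / (2 * e m)) * T (n m) z"
          using T_lin[OF yz, of "n m" "1 / (2 * e m)" "- 1 / (2 * e m)"] e0[of m] by simp
        then have "e m * T (n m) (u m) \<le> (T (n m) y + T (n m) z) / 2"
          using e0[of m] by (simp add: field_simps)
        then have "e m * T (n m) (u m) \<le> T (n m) y \<or> e m * T (n m) (u m) \<le> T (n m) z"
          by (cases "T (n m) y \<le> T (n m) z") (auto simp: field_simps)
        then have "step m x y \<or> step m x z" unfolding step_def
          using y_def z_def e0[of m] by (metis abs_minus_cancel abs_of_pos)
        then show "\<exists>y. (y \<in> V \<and> (Suc m = 0 \<longrightarrow> y = (\<lambda>_. 0))) \<and> step m x y" using yz by auto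
      qed
      then show ?thesis by blast
    qed
    then obtain X where X: "\<And>m. X m \<in> V" "X 0 = (\<lambda>_. 0)" "\<And>m. step m (X m) (X (Suc m))" by blast
    have Xl: "X m \<in> ell2" for m using X(1) V by auto
    have incr: "nrm (\<lambda>k. X (Suc m) k - X m k) \<le> e m" for m
    proof -
      obtain s where s: "\<bar>s\<bar> = e m" "X (Suc m) = (\<lambda>k. 1 * X m k + s * u m k)"
        using X(3)[of m] unfolding step_def by blast
      have "(\<lambda>k. X (Suc m) k - X m k) = (\<lambda>k. s * u m k)" using s by auto
      then show ?thesis using ell2_scale(2)[of "u m" s] uV[of m] V s e0[of m]
        by (auto simp: mult_left_le)
    qed
    have incr2: "nrm (\<lambda>k. X (m + j) k - X m k) \<le> 3 / 2 * e m" for m j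
    proof -
      have "nrm (\<lambda>k. X (m + j) k - X m k) \<le> 3 / 2 * (e m - e (m + j))"
      proof (induction j)
        case 0 show ?case by (simp add: nrm0)
      next
        case (Suc j)
        have "(\<lambda>k. X (m + Suc j) k - X m k) = (\<lambda>k. (X (Suc (m + j)) k - X (m + j) k) + (X (m + j) k - X m k))"
          by auto
        then have "nrm (\<lambda>k. X (m + Suc j) k - X m k) \<le> e (m + j) + nrm (\<lambda>k. X (m + j) k - X m k)"
          using ell2_add(2)[OF ell2_diff(1)[OF Xl Xl] ell2_diff(1)[OF Xl Xl], of "Suc (m + j)" "m + j" "m + j" m] incr[of "m + j"]
          by simp
        with Suc show ?case by (simp add: e_def)
      qed
      also have "\<dots> \<le> 3 / 2 * e m" using e0[of "m + j"] by simp
      finally show ?thesis .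
    qed
    have "\<exists>l. (\<lambda>m. X m k) \<longlonglongrightarrow> l" for k
    proof -
      have "\<bar>X (Suc m) k - X m k\<bar> \<le> e m / sqrt (w k)" for m
      proof -
        have "\<bar>X (Suc m) k - X m k\<bar> \<le> nrm (\<lambda>k. X (Suc m) k - X m k) / sqrt (w k)"
          by (rule coordinate_le_nrm[OF ell2_diff(1)[OF Xl Xl]])
        also have "\<dots> \<le> e m / sqrt (w k)" by (intro divide_right_mono incr) (simp add: w_nonneg)
        finally show ?thesis .
      qed
      moreover have "summable (\<lambda>m. e m / sqrt (w k))" unfolding e_def
        by (intro summable_divide summable_geometric) simp
      ultimately have "summable (\<lambda>m. X (Suc m) k - X m k)"
        using summable_comparison_test'[of "\<lambda>m. e m / sqrt (w k)" 0 "\<lambda>m. X (Suc m) k - X m k"] by simp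
      then have "(\<lambda>N. \<Sum>m<N. X (Suc m) k - X m k) \<longlonglongrightarrow> (\<Sum>m. X (Suc m) k - X m k)"
        by (rule summable_LIMSEQ)
      moreover have "(\<Sum>m<N. X (Suc m) k - X m k) = X N k" for N
        using sum_lessThan_telescope[of "\<lambda>m. X m k" N] X(2) by simp
      ultimately have "(\<lambda>N. X N k) \<longlonglongrightarrow> (\<Sum>m. X (Suc m) k - X m k)" by simp
      then show ?thesis by (rule exI)
    qed
    then have "\<forall>k. \<exists>l. (\<lambda>m. X m k) \<longlonglongrightarrow> l" by blast
    from choice[OF this] obtain x where x: "\<And>k. (\<lambda>m. X m k) \<longlonglongrightarrow> x k" by blast
    have dist: "(\<lambda>k. x k - X m k) \<in> ell2" "nrm (\<lambda>k. x k - X m k) \<le> 3 / 2 * e m" for m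
    proof -
      have lim: "(\<lambda>j. X (m + j) k - X m k) \<longlonglongrightarrow> x k - X m k" for k
        using LIMSEQ_ignore_initial_segment[OF x[of k], of m]
        by (intro tendsto_intros) (simp add: add.commute)
      from ell2_Fatou[of "\<lambda>j k. X (m + j) k - X m k", OF ell2_diff(1)[OF Xl Xl] incr2 lim]
      show "(\<lambda>k. x k - X m k) \<in> ell2" "nrm (\<lambda>k. x k - X m k) \<le> 3 / 2 * e m" by auto
    qed
    have xl: "x \<in> ell2" using dist(1)[of 0] X(2) by simp
    have nsym: "nrm (\<lambda>k. X m k - x k) = nrm (\<lambda>k. x k - X m k)" for m
      by (simp add: nrm_def power2_commute[of "X m _"])
    have "(\<lambda>m. nrm (\<lambda>k. X m k - x k)) \<longlonglongrightarrow> 0"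
    proof (rule Lim_null_comparison)
      have "norm (nrm (\<lambda>k. X m k - x k)) \<le> 3 / 2 * e m" for m
        unfolding nsym using dist(2)[of m] nrm_nonneg[of "\<lambda>k. x k - X m k"] by simp
      then show "\<forall>\<^sub>F m in sequentially. norm (nrm (\<lambda>k. X m k - x k)) \<le> 3 / 2 * e m"
        by (rule always_eventually[OF allI])
      show "(\<lambda>m. 3 / 2 * e m) \<longlonglongrightarrow> 0" unfolding e_def
        by (intro tendsto_mult_right_zero LIMSEQ_power_zero) simp
    qed
    then have xV: "x \<in> V" using V_closed X(1) xl by blast
    \<comment> \<open>The gain at step \<open>m\<close> is at least \<open>3 / 4 * \<tau> (n m) * e m\<close>; all later steps undo at most
      \<open>3 / 2 * \<tau> (n m) * e (Suc m)\<close>, which is \<open>\<tau> (n m) * e m / 2\<close>.\<close>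
    have "real m \<le> nrm (L x)" for m
    proof -
      let ?y = "\<lambda>k. 1 * X (Suc m) k + (-1) * x k"
      have yV: "?y \<in> V" using V_lin X(1) xV by blast
      have ny: "nrm ?y \<le> 3 / 2 * e (Suc m)" using dist(2)[of "Suc m"] nsym[of "Suc m"] by simp
      have "X (Suc m) = (\<lambda>k. 1 * x k + 1 * ?y k)" by auto
      then have "T (n m) (X (Suc m)) \<le> T (n m) x + T (n m) ?y"
        using T_lin[OF xV yV, of "n m" 1 1] by simp
      also have "T (n m) ?y \<le> \<tau> (n m) * (3 / 2 * e (Suc m))"
        using T_le[OF yV, of "n m"] mult_left_mono[OF ny \<tau>0[of "n m"]] by linarith
      also have "\<dots> = \<tau> (n m) * e m / 2" by (simp add: e_def)
      finally have 1: "T (n m) (X (Suc m)) \<le> T (n m) x + \<tau> (n m) * e m / 2" by simp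
      have "e m * (3 / 4 * \<tau> (n m)) \<le> e m * T (n m) (u m)" using u(2)[of m] e0[of m] by simp
      also have "\<dots> \<le> T (n m) (X (Suc m))" using X(3)[of m] by (simp add: step_def)
      finally have "\<tau> (n m) * e m / 4 \<le> T (n m) x" using 1 by (simp add: algebra_simps)
      moreover have "real m = (4 * 3 ^ m * real m) * e m / 4" by (simp add: e_def power_one_over)
      moreover have "\<dots> \<le> \<tau> (n m) * e m / 4" using n[of m] e0[of m] by simp
      moreover have "T (n m) x \<le> nrm (L x)" unfolding T_def using L_into[OF xV] by (rule partial_nrm_le)
      ultimately show ?thesis by linarith
    qed
    then show False using reals_Archimedean2[of "nrm (L x)"] by (meson not_le)
  qed
  then obtain C where C: "\<And>N. \<tau> N \<le> C" by blast
  have C0: "0 \<le> C" using C[of 0] \<tau>0[of 0] by linarith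
  have "nrm (L x) \<le> C * nrm x" if x: "x \<in> V" for x
  proof (rule ell2_of_bounded_sums)
    show "0 \<le> C * nrm x" using C0 nrm_nonneg by simp
    have "T N x \<le> C * nrm x" for N using T_le[OF x, of N] mult_right_mono[OF C nrm_nonneg, of N x] by linarith
    then show "(\<Sum>k<N. w k * (L x k)\<^sup>2) \<le> (C * nrm x)\<^sup>2" for N
      using power_mono[OF _ T0[of N x], of "C * nrm x" 2] by (simp add: T_def partial_nrm_sq)
  qed
  with C0 show ?thesis by blast
qed

end

section \<open>Jump parts, tails and summation by parts\<close>

definition jump_part :: "nat set \<Rightarrow> (nat \<Rightarrow> 'a::ab_group_add) \<Rightarrow> nat \<Rightarrow> 'a" where
  "jump_part S v k = (\<Sum>j\<in>{1..k} \<inter> S. v j - v (j - 1))"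

lemma jump_part_0 [simp]: "jump_part S v 0 = 0"
  by (simp add: jump_part_def)

lemma jump_part_Suc:
  "jump_part S v (Suc k) = jump_part S v k + (if Suc k \<in> S then v (Suc k) - v k else 0)"
proof -
  have "{1..Suc k} \<inter> S = (if Suc k \<in> S then insert (Suc k) ({1..k} \<inter> S) else {1..k} \<inter> S)"
    using le_Suc_eq by auto
  then show ?thesis by (simp add: jump_part_def add.commute)
qed

definition tail_sum :: "(nat \<Rightarrow> 'a::real_normed_vector) \<Rightarrow> nat \<Rightarrow> 'a" where
  "tail_sum c k = (\<Sum>j. c (j + k))"

lemma tail_sum_0: "tail_sum c 0 = suminf c"
  by (simp add: tail_sum_def)

lemma tail_sum_eq: "summable c \<Longrightarrow> tail_sum c k = suminf c - sum c {..<k}"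
  unfolding tail_sum_def using suminf_split_initial_segment[of c k] by simp

lemma tail_sum_step: "summable c \<Longrightarrow> c k = tail_sum c k - tail_sum c (Suc k)"
  by (simp add: tail_sum_eq)

lemma tail_sum_tendsto_0: assumes "summable c" shows "tail_sum c \<longlonglongrightarrow> 0"
proof -
  have "(\<lambda>k. suminf c - sum c {..<k}) \<longlonglongrightarrow> suminf c - suminf c"
    by (intro tendsto_intros summable_LIMSEQ assms)
  moreover have "tail_sum c = (\<lambda>k. suminf c - sum c {..<k})"
    using tail_sum_eq[OF assms] by (rule ext)
  ultimately show ?thesis by simp
qed

lemma tail_sum_add: "summable c \<Longrightarrow> summable d \<Longrightarrow>
    tail_sum (\<lambda>k. c k + d k) k = tail_sum c k + tail_sum d k"
  by (simp add: tail_sum_eq suminf_add summable_add sum.distrib)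

lemma sums_tail_sum:
  assumes "summable c" shows "(\<lambda>j. if k \<le> j then c j else 0) sums tail_sum c k"
proof -
  have "(\<lambda>j. c (j + k)) sums tail_sum c k"
    unfolding tail_sum_def using assms summable_iff_shift[of c k] by (simp add: summable_sums)
  then show ?thesis
    using sums_iff_shift[of "\<lambda>j. if k \<le> j then c j else 0" k "tail_sum c k"] by simp
qed

lemma summation_by_parts:
  fixes c v :: "nat \<Rightarrow> 'a::comm_ring"
  assumes "\<And>k. c k = T k - T (Suc k)"
  shows "(\<Sum>k\<le>m. c k * v k) =
    T 0 * v 0 + (\<Sum>k<m. T (Suc k) * (v (Suc k) - v k)) - T (Suc m) * v m"
  by (induction m) (simp_all add: assms algebra_simps)

text \<open>
  By summation by parts the partial sum up to \<open>m\<close> is \<open>- tail_sum c (Suc m) * v m\<close>, since \<open>v\<close> only jumps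
  where the tail of \<open>c\<close> vanishes. It is zero whenever \<open>Suc m\<close> lies in \<open>S\<close>.
  Passing to these \<open>m\<close> is essential: in general the boundary term need not tend to zero.
\<close>

lemma suminf_mult_eq_0_if_tails_vanish:
  fixes c v :: "nat \<Rightarrow> 'a::real_normed_field"
  assumes c: "summable c" and cv: "summable (\<lambda>k. c k * v k)"
    and tails: "tail_sum c 0 = 0" "\<And>k. k \<in> S \<Longrightarrow> tail_sum c k = 0"
    and v: "\<And>k. Suc k \<notin> S \<Longrightarrow> v (Suc k) = v k" and S: "infinite S"
  shows "(\<Sum>k. c k * v k) = 0"
proof (rule ccontr)
  assume ne: "(\<Sum>k. c k * v k) \<noteq> 0"
  have part: "(\<Sum>k\<le>m. c k * v k) = - tail_sum c (Suc m) * v m" for m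
  proof -
    have "(\<Sum>k<m. tail_sum c (Suc k) * (v (Suc k) - v k)) = 0"
      by (rule sum.neutral) (use tails(2) v in fastforce)
    then show ?thesis
      using summation_by_parts[of c "tail_sum c" v m, OF tail_sum_step[OF c]] tails(1) by simp
  qed
  have "(\<lambda>m. \<Sum>k\<le>m. c k * v k) \<longlonglongrightarrow> (\<Sum>k. c k * v k)" by (rule summable_LIMSEQ'[OF cv])
  from tendsto_imp_eventually_ne[OF this ne]
  obtain M where M: "\<And>m. m \<ge> M \<Longrightarrow> (\<Sum>k\<le>m. c k * v k) \<noteq> 0" by (auto simp: eventually_sequentially)
  obtain k where k: "k \<in> S" "k > Suc M" using S infinite_nat_iff_unbounded by blast
  then obtain m where m: "k = Suc m" by (cases k) auto
  show False using M[of m] part[of m] tails(2)[OF k(1)] k(2) m by simp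
qed

text \<open>
  For the weighted inner product, \<open>jump_adjoint w S\<close> is the adjoint of \<open>jump_part S\<close>: the tails of
  \<open>jump_adjoint w S x\<close> agree with those of \<open>x\<close> on \<open>S\<close> and vanish elsewhere.
\<close>

definition masked_tail :: "(nat \<Rightarrow> real) \<Rightarrow> nat set \<Rightarrow> (nat \<Rightarrow> 'a::real_normed_vector) \<Rightarrow> nat \<Rightarrow> 'a" where
  "masked_tail w S x k = (if k \<in> S then tail_sum (\<lambda>j. w j *\<^sub>R x j) k else 0)"

definition jump_adjoint :: "(nat \<Rightarrow> real) \<Rightarrow> nat set \<Rightarrow> (nat \<Rightarrow> 'a::real_normed_vector) \<Rightarrow> nat \<Rightarrow> 'a" where
  "jump_adjoint w S x k = (masked_tail w S x k - masked_tail w S x (Suc k)) /\<^sub>R w k"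

section \<open>Boundedness of jump parts and of their adjoints\<close>

context positive_weights
begin

lemma weight_jump_adjoint:
  "w k *\<^sub>R jump_adjoint w S x k = masked_tail w S x k - masked_tail w S x (Suc k)"
  using w_pos[of k] by (simp add: jump_adjoint_def)

lemma abs_tail_le_nrm: assumes "x \<in> ell2" shows "\<bar>tail_sum (\<lambda>j. w j * x j) k\<bar> \<le> nrm x"
proof -
  have s: "summable (\<lambda>j. \<bar>w (j + k) * x (j + k)\<bar>)"
    using ell2_summable_abs(1)[OF assms] summable_iff_shift[of "\<lambda>j. \<bar>w j * x j\<bar>" k] by simp
  have "\<bar>tail_sum (\<lambda>j. w j * x j) k\<bar> \<le> (\<Sum>j. \<bar>w (j + k) * x (j + k)\<bar>)"
    unfolding tail_sum_def by (rule summable_rabs[OF s])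
  also have "\<dots> \<le> (\<Sum>j. \<bar>w j * x j\<bar>)"
    using suminf_split_initial_segment[OF ell2_summable_abs(1)[OF assms], of k] by (simp add: sum_nonneg)
  also have "\<dots> \<le> nrm x" by (rule ell2_summable_abs(2)[OF assms])
  finally show ?thesis .
qed

lemma abs_jump_adjoint_le: assumes "x \<in> ell2" shows "\<bar>jump_adjoint w S x k\<bar> \<le> 2 / w k * nrm x"
proof -
  have m: "\<bar>masked_tail w S x k\<bar> \<le> nrm x" for k
    using abs_tail_le_nrm[OF assms, of k] nrm_nonneg[of x] by (simp add: masked_tail_def)
  have "w k * \<bar>jump_adjoint w S x k\<bar> = \<bar>w k *\<^sub>R jump_adjoint w S x k\<bar>"
    by (simp add: abs_mult w_nonneg)
  also have "\<dots> \<le> 2 * nrm x" unfolding weight_jump_adjoint using m[of k] m[of "Suc k"] by linarith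
  finally show ?thesis using w_pos[of k] by (simp add: field_simps)
qed

lemma jump_adjoint_linear:
  assumes "x \<in> ell2" "y \<in> ell2"
  shows "jump_adjoint w S (\<lambda>k. a * x k + b * y k) k = a * jump_adjoint w S x k + b * jump_adjoint w S y k"
proof -
  have "tail_sum (\<lambda>j. w j * (a * x j + b * y j)) k = a * tail_sum (\<lambda>j. w j * x j) k + b * tail_sum (\<lambda>j. w j * y j) k" for k
  proof -
    have s: "summable (\<lambda>j. w (j + k) * x (j + k))" "summable (\<lambda>j. w (j + k) * y (j + k))"
      using ell2_summable[OF assms(1)] ell2_summable[OF assms(2)]
        summable_iff_shift[of "\<lambda>j. w j * x j" k] summable_iff_shift[of "\<lambda>j. w j * y j" k] by simp_all
    have "(\<lambda>j. a * (w (j + k) * x (j + k)) + b * (w (j + k) * y (j + k))) sums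
        (a * tail_sum (\<lambda>j. w j * x j) k + b * tail_sum (\<lambda>j. w j * y j) k)"
      unfolding tail_sum_def by (intro sums_add sums_mult summable_sums s)
    moreover have "w j * (a * x j + b * y j) = a * (w j * x j) + b * (w j * y j)" for j
      by (simp add: algebra_simps)
    ultimately show ?thesis by (simp add: tail_sum_def sums_iff)
  qed
  then have "masked_tail w S (\<lambda>k. a * x k + b * y k) k = a * masked_tail w S x k + b * masked_tail w S y k" for k
    by (simp add: masked_tail_def)
  then show ?thesis by (simp add: jump_adjoint_def algebra_simps)
qed

lemma jump_part_const_from:
  fixes v :: "nat \<Rightarrow> 'b::ab_group_add"
  assumes "\<And>k. N \<le> k \<Longrightarrow> v k = 0" "N \<le> k"
  shows "jump_part S v k = jump_part S v N"
  using assms(2) by (induction k rule: dec_induct) (auto simp: jump_part_Suc assms(1))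

lemma jump_part_ell2_of_finite_support:
  fixes v :: "nat \<Rightarrow> real"
  assumes "\<And>k. N \<le> k \<Longrightarrow> v k = 0"
  shows "jump_part S v \<in> ell2"
proof (rule ell2_bounded(1))
  fix k
  have "jump_part S v k = jump_part S v (min k N)"
    using jump_part_const_from[of N v k S, OF assms] by (cases "N \<le> k") (auto simp: min_def)
  also have "\<bar>\<dots>\<bar> \<le> (\<Sum>j\<le>N. \<bar>jump_part S v j\<bar>)" by (rule member_le_sum) auto
  finally show "\<bar>jump_part S v k\<bar> \<le> (\<Sum>j\<le>N. \<bar>jump_part S v j\<bar>)" .
qed

lemma ell2_of_finite_support:
  assumes "\<And>k. N \<le> k \<Longrightarrow> v k = 0"
  shows "v \<in> ell2" "(nrm v)\<^sup>2 = (\<Sum>k<N. w k * (v k)\<^sup>2)"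
proof -
  have "(\<lambda>k. w k * (v k)\<^sup>2) sums (\<Sum>k<N. w k * (v k)\<^sup>2)"
    by (rule sums_finite) (use assms in auto)
  then show "v \<in> ell2" "(nrm v)\<^sup>2 = (\<Sum>k<N. w k * (v k)\<^sup>2)"
    by (auto simp: ell2_def sums_iff nrm_sq)
qed

text \<open>
  Both sides are summed by parts. The jumps of \<open>jump_part S v\<close> are those of \<open>v\<close> on \<open>S\<close>, so the results
  agree up to the boundary term \<open>tail_sum _ (Suc m) * jump_part S v N\<close>, which vanishes in the limit.
\<close>

lemma jump_adjoint_pairing:
  fixes x v :: "nat \<Rightarrow> real"
  assumes S: "0 \<notin> S" and x: "x \<in> ell2" and v: "\<And>k. N \<le> k \<Longrightarrow> v k = 0"
  shows "(\<Sum>k<N. w k * jump_adjoint w S x k * v k) = (\<Sum>k. w k * x k * jump_part S v k)"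
proof -
  let ?T = "tail_sum (\<lambda>j. w j * x j)" and ?s = "masked_tail w S x" and ?Q = "jump_part S v"
  let ?A = "\<Sum>k<N. w k * jump_adjoint w S x k * v k"
  have sx: "summable (\<lambda>j. w j * x j)" by (rule ell2_summable[OF x])
  have eq: "(\<Sum>k\<le>m. w k * x k * ?Q k) = ?A - ?T (Suc m) * ?Q N" if "N \<le> m" for m
  proof -
    have "?A = (\<Sum>k\<le>m. w k * jump_adjoint w S x k * v k)"
      by (rule sum.mono_neutral_left) (use that v in auto)
    also have "\<dots> = ?s 0 * v 0 + (\<Sum>k<m. ?s (Suc k) * (v (Suc k) - v k)) - ?s (Suc m) * v m"
      by (rule summation_by_parts) (use weight_jump_adjoint[of _ S x] in simp)
    also have "\<dots> = (\<Sum>k<m. ?T (Suc k) * (?Q (Suc k) - ?Q k))"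
      using S v[OF that] by (auto simp: masked_tail_def jump_part_Suc intro!: sum.cong)
    finally have A: "?A = (\<Sum>k<m. ?T (Suc k) * (?Q (Suc k) - ?Q k))" .
    have "(\<Sum>k\<le>m. w k * x k * ?Q k) = ?T 0 * ?Q 0 + (\<Sum>k<m. ?T (Suc k) * (?Q (Suc k) - ?Q k)) - ?T (Suc m) * ?Q m"
      by (rule summation_by_parts) (rule tail_sum_step[OF sx])
    then show ?thesis using A jump_part_const_from[of N v m S, OF v that] by simp
  qed
  have "(\<lambda>m. ?A - ?T (Suc m) * ?Q N) \<longlonglongrightarrow> ?A - 0 * ?Q N"
    by (intro tendsto_intros LIMSEQ_Suc tail_sum_tendsto_0 sx)
  then have "(\<lambda>m. ?A - ?T (Suc m) * ?Q N) \<longlonglongrightarrow> ?A" by simp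
  moreover have "\<forall>\<^sub>F m in sequentially. ?A - ?T (Suc m) * ?Q N = (\<Sum>k\<le>m. w k * x k * ?Q k)"
    unfolding eventually_sequentially using eq by (intro exI[of _ N] allI impI) (rule sym)
  ultimately have "(\<lambda>m. \<Sum>k\<le>m. w k * x k * ?Q k) \<longlonglongrightarrow> ?A" by (rule Lim_transform_eventually)
  moreover have "(\<lambda>m. \<Sum>k\<le>m. w k * x k * ?Q k) \<longlonglongrightarrow> (\<Sum>k. w k * x k * ?Q k)"
    by (rule summable_LIMSEQ'[OF ell2_mult(2)[OF x jump_part_ell2_of_finite_support[OF v]]])
  ultimately show ?thesis by (rule LIMSEQ_unique)
qed

lemma jump_part_linear:
  "jump_part S (\<lambda>k. a * x k + b * y k) k = a * jump_part S x k + b * jump_part S (y :: nat \<Rightarrow> real) k"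
  by (induction k) (auto simp: jump_part_Suc algebra_simps)

lemma jump_part_bounded:
  assumes "\<And>v. v \<in> ell2 \<Longrightarrow> jump_part S v \<in> ell2"
  shows "\<exists>C\<ge>0. \<forall>v\<in>ell2. nrm (jump_part S v) \<le> C * nrm v"
proof (rule everywhere_defined_operator_bounded)
  show "ell2 \<noteq> {}" using ell2_const by blast
  show "\<exists>c. \<forall>x\<in>ell2. \<bar>jump_part S x k\<bar> \<le> c * nrm x" for k
  proof (induction k)
    case 0 show ?case by (auto intro!: exI[of _ 0])
  next
    case (Suc k)
    then obtain c where c: "\<forall>x\<in>ell2. \<bar>jump_part S x k\<bar> \<le> c * nrm x" by blast
    have "\<bar>jump_part S x (Suc k)\<bar> \<le> (c + 1 / sqrt (w (Suc k)) + 1 / sqrt (w k)) * nrm x" if "x \<in> ell2" for x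
    proof -
      have n: "0 \<le> nrm x / sqrt (w j)" for j using nrm_nonneg w_nonneg by simp
      have "\<bar>jump_part S x (Suc k)\<bar> \<le> \<bar>jump_part S x k\<bar> + nrm x / sqrt (w (Suc k)) + nrm x / sqrt (w k)"
        using coordinate_le_nrm[OF that, of k] coordinate_le_nrm[OF that, of "Suc k"] n[of k] n[of "Suc k"]
        by (auto simp: jump_part_Suc)
      also have "\<dots> \<le> (c + 1 / sqrt (w (Suc k)) + 1 / sqrt (w k)) * nrm x"
        using c that by (simp add: algebra_simps)
      finally show ?thesis .
    qed
    then show ?case by blast
  qed
  show "(\<lambda>k. a * x k + b * y k) \<in> ell2" if "x \<in> ell2" "y \<in> ell2" for x y a b
    by (rule ell2_lincomb[OF that])
  show "jump_part S (\<lambda>k. a * x k + b * y k) k = a * jump_part S x k + b * jump_part S y k"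
    for x y :: "nat \<Rightarrow> real" and a b k by (rule jump_part_linear)
qed (rule assms subset_refl | assumption)+

text \<open>
  Pairing \<open>y = jump_adjoint w S x\<close> with its own truncation \<open>v\<close> turns a bound \<open>C\<close> for the jump part into
  \<open>(nrm v)\<^sup>2 \<le> nrm x * C * nrm v\<close>, a bound on \<open>nrm v\<close> that does not depend on where \<open>y\<close> is cut off.
\<close>

lemma jump_adjoint_ell2:
  fixes x :: "nat \<Rightarrow> real"
  assumes S: "0 \<notin> S" and Q: "\<And>v. v \<in> ell2 \<Longrightarrow> jump_part S v \<in> ell2" and x: "x \<in> ell2"
  shows "jump_adjoint w S x \<in> ell2"
proof -
  obtain C where C: "0 \<le> C" "\<And>v. v \<in> ell2 \<Longrightarrow> nrm (jump_part S v) \<le> C * nrm v"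
    using jump_part_bounded[OF Q] by blast
  have "(\<Sum>k<N. w k * (jump_adjoint w S x k)\<^sup>2) \<le> (nrm x * C)\<^sup>2" for N
  proof -
    define v where "v k = (if k < N then jump_adjoint w S x k else 0)" for k
    have v0: "v k = 0" if "N \<le> k" for k using that by (simp add: v_def)
    note v = ell2_of_finite_support[of N v, OF v0]
    have sq: "(nrm v)\<^sup>2 = (\<Sum>k<N. w k * (jump_adjoint w S x k)\<^sup>2)" using v(2) by (simp add: v_def)
    have "(nrm v)\<^sup>2 = (\<Sum>k<N. w k * jump_adjoint w S x k * v k)"
      unfolding sq by (rule sum.cong) (auto simp: v_def power2_eq_square)
    also have "\<dots> = (\<Sum>k. w k * x k * jump_part S v k)" by (rule jump_adjoint_pairing[OF S x v0])
    also have "\<dots> \<le> nrm x * nrm (jump_part S v)" using ell2_mult(4)[OF x Q[OF v(1)]] by linarith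
    also have "\<dots> \<le> nrm x * (C * nrm v)" by (intro mult_left_mono C(2) v(1) nrm_nonneg)
    finally have "nrm v * nrm v \<le> (nrm x * C) * nrm v" by (simp add: power2_eq_square)
    then have "nrm v \<le> nrm x * C" using nrm_nonneg[of v] nrm_nonneg[of x] C(1)
      by (cases "nrm v = 0") (auto simp: mult_le_cancel_right)
    then show ?thesis using power_mono[OF _ nrm_nonneg, of v "nrm x * C" 2] sq by simp
  qed
  then show ?thesis using ell2_of_bounded_sums(1) C(1) nrm_nonneg[of x] by (metis mult_nonneg_nonneg)
qed

text \<open>
  The converse of \<open>jump_adjoint_ell2\<close>. For finitely supported \<open>u\<close>, the centred jump part \<open>x\<close> of \<open>u\<close> lies in
  the space \<open>V\<close> on which the adjoint is bounded, and pairing \<open>x\<close> with itself bounds \<open>x\<close> by \<open>u\<close>. The mean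
  that was subtracted is recovered at index \<open>0\<close>, where the jump part is zero and \<open>x\<close> is minus this mean.
  The general case follows because the jump part up to \<open>N\<close> only depends on the sequence up to \<open>N\<close>.
\<close>

lemma jump_part_ell2_of_adjoint:
  fixes S :: "nat set"
  assumes S: "0 \<notin> S" and D: "\<And>x :: nat \<Rightarrow> real. x \<in> ell2 \<Longrightarrow> (\<And>k. Suc k \<notin> S \<Longrightarrow> x (Suc k) = x k) \<Longrightarrow>
      (\<Sum>k. w k * x k) = 0 \<Longrightarrow> jump_adjoint w S x \<in> ell2"
    and v: "v \<in> ell2"
  shows "jump_part S v \<in> ell2"
proof -
  define V where "V = {x \<in> ell2. (\<forall>k. Suc k \<notin> S \<longrightarrow> x (Suc k) = x k) \<and> (\<Sum>k. w k * x k) = 0}"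
  have "\<exists>C\<ge>0. \<forall>x\<in>V. nrm (jump_adjoint w S x) \<le> C * nrm x"
  proof (rule everywhere_defined_operator_bounded)
    show "V \<subseteq> ell2" by (auto simp: V_def)
    show "V \<noteq> {}" using ell2_const[of 0] by (auto simp: V_def intro!: exI[of _ "\<lambda>_. 0"])
    show "(\<lambda>k. a * x k + b * y k) \<in> V" if "x \<in> V" "y \<in> V" for x y a b
    proof -
      have "(\<lambda>k. a * (w k * x k) + b * (w k * y k)) sums (a * 0 + b * 0)"
        using that ell2_summable[of x] ell2_summable[of y]
        by (intro sums_add sums_mult) (auto simp: V_def sums_iff)
      moreover have "a * (w k * x k) + b * (w k * y k) = w k * (a * x k + b * y k)" for k
        by (simp add: algebra_simps)
      ultimately show ?thesis using that by (auto simp: V_def ell2_lincomb sums_iff)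
    qed
    show "x \<in> V" if X: "\<And>m. X m \<in> V" and x: "x \<in> ell2" and lim: "(\<lambda>m. nrm (\<lambda>k. X m k - x k)) \<longlonglongrightarrow> 0" for X x
    proof -
      have Xl: "X m \<in> ell2" for m using X[of m] by (simp add: V_def)
      note d = ell2_diff(1)[OF Xl x]
      have pt: "(\<lambda>m. X m k) \<longlonglongrightarrow> x k" for k
      proof -
        have "(\<lambda>m. nrm (\<lambda>k. X m k - x k) / sqrt (w k)) \<longlonglongrightarrow> 0" using tendsto_divide_zero[OF lim] .
        then have "(\<lambda>m. X m k - x k) \<longlonglongrightarrow> 0"
          by (rule Lim_null_comparison[rotated]) (use coordinate_le_nrm[OF d] in simp)
        then show ?thesis by (rule Lim_null[THEN iffD2])
      qed
      have "x (Suc k) = x k" if "Suc k \<notin> S" for k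
      proof -
        have "X m (Suc k) = X m k" for m using X[of m] that by (simp add: V_def)
        then have "(\<lambda>m. X m k) \<longlonglongrightarrow> x (Suc k)" using pt[of "Suc k"] by simp
        then show ?thesis using pt LIMSEQ_unique by blast
      qed
      moreover have "(\<Sum>k. w k * x k) = 0"
      proof -
        have "\<bar>\<Sum>k. w k * x k\<bar> \<le> nrm (\<lambda>k. X m k - x k)" for m
        proof -
          have "(\<lambda>k. w k * X m k - w k * x k) sums (0 - (\<Sum>k. w k * x k))"
            using X[of m] ell2_summable[OF Xl] ell2_summable[OF x]
            by (intro sums_diff) (auto simp: V_def sums_iff)
          then have "tail_sum (\<lambda>k. w k * (X m k - x k)) 0 = - (\<Sum>k. w k * x k)"
            by (simp add: tail_sum_def sums_iff right_diff_distrib)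
          then show ?thesis using abs_tail_le_nrm[OF d, of m 0] by simp
        qed
        then have "\<bar>\<Sum>k. w k * x k\<bar> \<le> 0" by (intro LIMSEQ_le_const[OF lim]) auto
        then show ?thesis by simp
      qed
      ultimately show ?thesis using x by (simp add: V_def)
    qed
    show "jump_adjoint w S (\<lambda>k. a * x k + b * y k) k = a * jump_adjoint w S x k + b * jump_adjoint w S y k"
      if "x \<in> V" "y \<in> V" for x y a b k using jump_adjoint_linear that by (simp add: V_def)
    show "\<exists>c. \<forall>x\<in>V. \<bar>jump_adjoint w S x k\<bar> \<le> c * nrm x" for k
      by (rule exI[of _ "2 / w k"]) (use abs_jump_adjoint_le in \<open>auto simp: V_def\<close>)
    show "jump_adjoint w S x \<in> ell2" if "x \<in> V" for x using D that by (simp add: V_def)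
  qed
  then obtain C where C: "0 \<le> C" "\<And>x. x \<in> V \<Longrightarrow> nrm (jump_adjoint w S x) \<le> C * nrm x" by blast
  define C' where "C' = C + C / sqrt (w 0)"
  have C'0: "0 \<le> C'" using C(1) w_nonneg by (simp add: C'_def)
  have fin: "nrm (jump_part S u) \<le> C' * nrm u" if u: "\<And>k. N \<le> k \<Longrightarrow> u k = 0" for u N
  proof -
    let ?Q = "jump_part S u"
    note Q = jump_part_ell2_of_finite_support[of N u S, OF u]
    note ul = ell2_of_finite_support(1)[of N u, OF u]
    define m where "m = (\<Sum>k. w k * ?Q k)"
    define x where "x k = ?Q k - m" for k
    have xl: "x \<in> ell2" unfolding x_def by (rule ell2_diff(1)[OF Q ell2_const])
    have sx: "(\<lambda>k. w k * x k) sums 0"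
    proof -
      have "(\<lambda>k. w k * ?Q k - w k * m) sums (m - 1 * m)"
        by (intro sums_diff sums_mult2 w_sums) (simp add: m_def summable_sums ell2_summable[OF Q])
      then show ?thesis by (simp add: x_def right_diff_distrib)
    qed
    have xV: "x \<in> V" using xl sx by (auto simp: V_def x_def jump_part_Suc sums_iff)
    have "(nrm x)\<^sup>2 = (\<Sum>k. w k * x k * ?Q k)"
    proof -
      have "(\<lambda>k. w k * x k * ?Q k - w k * x k * m) sums ((\<Sum>k. w k * x k * ?Q k) - 0 * m)"
        by (intro sums_diff sums_mult2 sx summable_sums ell2_mult(2)[OF xl Q])
      moreover have "w k * x k * ?Q k - w k * x k * m = w k * (x k)\<^sup>2" for k
        by (simp add: x_def power2_eq_square algebra_simps)
      ultimately show ?thesis by (simp add: nrm_sq[OF xl] sums_iff)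
    qed
    also have "\<dots> = (\<Sum>k<N. w k * jump_adjoint w S x k * u k)"
      by (rule jump_adjoint_pairing[OF S xl u, symmetric])
    also have "\<dots> = (\<Sum>k. w k * jump_adjoint w S x k * u k)"
      by (rule suminf_finite[symmetric]) (use u in auto)
    also have "\<dots> \<le> nrm (jump_adjoint w S x) * nrm u"
      using ell2_mult(4)[OF _ ul, of "jump_adjoint w S x"] D[OF xl] xV by (auto simp: V_def)
    also have "\<dots> \<le> (C * nrm x) * nrm u" by (intro mult_right_mono C(2) xV nrm_nonneg)
    finally have "nrm x * nrm x \<le> (C * nrm u) * nrm x" by (simp add: power2_eq_square ac_simps)
    then have nx: "nrm x \<le> C * nrm u" using nrm_nonneg[of x] nrm_nonneg[of u] C(1)
      by (cases "nrm x = 0") (auto simp: mult_le_cancel_right)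
    have "\<bar>m\<bar> \<le> nrm x / sqrt (w 0)" using coordinate_le_nrm[OF xl, of 0] by (simp add: x_def)
    also have "\<dots> \<le> C * nrm u / sqrt (w 0)" by (intro divide_right_mono nx) (simp add: w_nonneg)
    finally have m: "\<bar>m\<bar> \<le> C * nrm u / sqrt (w 0)" .
    have "nrm ?Q \<le> nrm x + nrm (\<lambda>_. m)"
      using ell2_add(2)[OF xl ell2_const[of m]] by (simp add: x_def)
    also have "nrm (\<lambda>_. m) \<le> \<bar>m\<bar>" by (rule ell2_bounded(2)) simp
    finally show ?thesis using nx m by (simp add: C'_def algebra_simps)
  qed
  show ?thesis
  proof (rule ell2_of_bounded_sums(1))
    show "0 \<le> C' * nrm v" using C'0 nrm_nonneg by simp
    fix N
    define u where "u k = (if k < N then v k else 0)" for k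
    have u0: "u k = 0" if "N \<le> k" for k using that by (simp add: u_def)
    have "(nrm u)\<^sup>2 \<le> (nrm v)\<^sup>2"
      using ell2_of_finite_support(2)[of N u, OF u0] sum_le_nrm_sq[OF v, of "{..<N}"] by (simp add: u_def)
    then have nu: "nrm u \<le> nrm v" by (rule power2_le_imp_le) (rule nrm_nonneg)
    have eq: "jump_part S u k = jump_part S v k" if "k < N" for k
      using that by (induction k) (auto simp: jump_part_Suc u_def)
    have "(\<Sum>k<N. w k * (jump_part S v k)\<^sup>2) = (\<Sum>k<N. w k * (jump_part S u k)\<^sup>2)"
      by (rule sum.cong) (auto simp: eq)
    also have "\<dots> \<le> (nrm (jump_part S u))\<^sup>2"
      by (rule sum_le_nrm_sq[OF jump_part_ell2_of_finite_support[OF u0]]) auto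
    also have "\<dots> \<le> (C' * nrm v)\<^sup>2"
    proof (rule power_mono[OF _ nrm_nonneg])
      show "nrm (jump_part S u) \<le> C' * nrm v"
        using fin[of N u, OF u0] mult_left_mono[OF nu C'0] by linarith
    qed
    finally show "(\<Sum>k<N. w k * (jump_part S v k)\<^sup>2) \<le> (C' * nrm v)\<^sup>2" .
  qed
qed

text \<open>
  With \<open>\<rho>\<close> for the tails of \<open>w\<close>, the energies \<open>\<rho> k * (Q k)\<^sup>2\<close> of the jump part \<open>Q\<close> contract by a factor
  \<open>q < 1\<close> from one index to the next, up to an error controlled by \<open>v\<close>: \<open>\<rho>\<close> shrinks by \<open>\<theta>\<close>, and Young's
  inequality separates the old value of \<open>Q\<close> from the new jump at the price of a factor \<open>1 + \<epsilon>\<close>. The error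
  is harmless since \<open>\<rho> k \<le> w k / (1 - \<theta>)\<close>. Summing the recursion bounds the sum of all energies.
\<close>

lemma jump_part_ell2_of_geometric_tails:
  fixes \<theta> :: real
  assumes \<theta>: "\<theta> < 1" "\<And>k. tail_sum w (Suc k) \<le> \<theta> * tail_sum w k" and v: "v \<in> ell2"
  shows "jump_part S v \<in> ell2"
proof -
  let ?\<rho> = "tail_sum w" and ?Q = "jump_part S v"
  have step: "w k = ?\<rho> k - ?\<rho> (Suc k)" for k by (rule tail_sum_step[OF w_summable])
  have \<rho>_nonneg: "0 \<le> ?\<rho> k" for k
    unfolding tail_sum_def using w_summable summable_iff_shift[of w k] by (intro suminf_nonneg) (simp_all add: w_nonneg)
  have \<rho>: "0 < ?\<rho> k" for k using step[of k] \<rho>_nonneg[of "Suc k"] w_pos[of k] by linarith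
  have \<theta>0: "0 < \<theta>"
  proof (rule ccontr)
    assume "\<not> 0 < \<theta>"
    then have "\<theta> * ?\<rho> 0 \<le> 0" using \<rho>[of 0] by (simp add: mult_nonpos_nonneg)
    then show False using \<theta>(2)[of 0] \<rho>[of 1] by simp
  qed
  have \<rho>_w: "?\<rho> k \<le> w k / (1 - \<theta>)" for k
    using step[of k] \<theta>(1) \<theta>(2)[of k] by (simp add: field_simps)
  \<comment> \<open>This choice puts \<open>q\<close> halfway between \<open>\<theta>\<close> and \<open>1\<close>.\<close>
  define \<epsilon> where "\<epsilon> = (1 - \<theta>) / (2 * \<theta>)"
  define q where "q = (1 + \<epsilon>) * \<theta>"
  have \<epsilon>: "0 < \<epsilon>" using \<theta>(1) \<theta>0 by (simp add: \<epsilon>_def)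
  have "q = (1 + \<theta>) / 2" using \<theta>0 by (simp add: q_def \<epsilon>_def field_simps)
  then have q: "0 < q" "q < 1" using \<theta>(1) \<theta>0 by simp_all
  have young: "(a + b)\<^sup>2 \<le> (1 + \<epsilon>) * a\<^sup>2 + (1 + 1 / \<epsilon>) * b\<^sup>2" for a b :: real
  proof -
    have "0 \<le> (\<epsilon> * a - b)\<^sup>2 / \<epsilon>" using \<epsilon> by simp
    also have "\<dots> = \<epsilon> * a\<^sup>2 - 2 * a * b + b\<^sup>2 / \<epsilon>" using \<epsilon> by (simp add: field_simps power2_eq_square)
    finally show ?thesis by (simp add: field_simps power2_eq_square)
  qed
  define D where "D = 2 * (1 + 1 / \<epsilon>) / (1 - \<theta>)"
  have D0: "0 \<le> D" using \<epsilon> \<theta>(1) by (simp add: D_def)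
  have rec: "?\<rho> (Suc k) * (?Q (Suc k))\<^sup>2 \<le> q * (?\<rho> k * (?Q k)\<^sup>2) + D * (w k * (v k)\<^sup>2 + w (Suc k) * (v (Suc k))\<^sup>2)" for k
  proof -
    define d where "d = (if Suc k \<in> S then v (Suc k) - v k else 0)"
    have d: "d\<^sup>2 \<le> 2 * (v k)\<^sup>2 + 2 * (v (Suc k))\<^sup>2"
    proof -
      have "(v (Suc k) - v k)\<^sup>2 + (v (Suc k) + v k)\<^sup>2 = 2 * (v k)\<^sup>2 + 2 * (v (Suc k))\<^sup>2"
        by (simp add: power2_eq_square algebra_simps)
      moreover have "0 \<le> (v (Suc k) + v k)\<^sup>2" by simp
      ultimately have "(v (Suc k) - v k)\<^sup>2 \<le> 2 * (v k)\<^sup>2 + 2 * (v (Suc k))\<^sup>2" by linarith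
      then show ?thesis by (simp add: d_def)
    qed
    have \<rho>le: "?\<rho> (Suc k) \<le> ?\<rho> k" using step[of k] w_nonneg[of k] by linarith
    have "?\<rho> (Suc k) * (?Q (Suc k))\<^sup>2 \<le> ?\<rho> (Suc k) * ((1 + \<epsilon>) * (?Q k)\<^sup>2 + (1 + 1 / \<epsilon>) * d\<^sup>2)"
      unfolding jump_part_Suc d_def[symmetric] by (intro mult_left_mono young \<rho>_nonneg)
    also have "\<dots> = ?\<rho> (Suc k) * ((1 + \<epsilon>) * (?Q k)\<^sup>2) + (1 + 1 / \<epsilon>) * (?\<rho> (Suc k) * d\<^sup>2)"
      by (simp add: algebra_simps)
    also have "?\<rho> (Suc k) * ((1 + \<epsilon>) * (?Q k)\<^sup>2) \<le> (\<theta> * ?\<rho> k) * ((1 + \<epsilon>) * (?Q k)\<^sup>2)"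
      using \<epsilon> by (intro mult_right_mono \<theta>(2)) simp
    also have "\<dots> = q * (?\<rho> k * (?Q k)\<^sup>2)" by (simp add: q_def)
    also have "?\<rho> (Suc k) * d\<^sup>2 \<le> 2 / (1 - \<theta>) * (w k * (v k)\<^sup>2 + w (Suc k) * (v (Suc k))\<^sup>2)"
    proof -
      have "?\<rho> (Suc k) * d\<^sup>2 \<le> ?\<rho> (Suc k) * (2 * (v k)\<^sup>2 + 2 * (v (Suc k))\<^sup>2)"
        by (intro mult_left_mono d \<rho>_nonneg)
      also have "\<dots> = 2 * (?\<rho> (Suc k) * (v k)\<^sup>2 + ?\<rho> (Suc k) * (v (Suc k))\<^sup>2)" by (simp add: algebra_simps)
      also have "\<dots> \<le> 2 * (w k / (1 - \<theta>) * (v k)\<^sup>2 + w (Suc k) / (1 - \<theta>) * (v (Suc k))\<^sup>2)"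
        using \<rho>le \<rho>_w[of k] \<rho>_w[of "Suc k"] by (intro mult_left_mono add_mono mult_right_mono) auto
      also have "\<dots> = 2 / (1 - \<theta>) * (w k * (v k)\<^sup>2 + w (Suc k) * (v (Suc k))\<^sup>2)" by (simp add: algebra_simps)
      finally show ?thesis .
    qed
    finally have "?\<rho> (Suc k) * (?Q (Suc k))\<^sup>2 \<le> q * (?\<rho> k * (?Q k)\<^sup>2) +
        (1 + 1 / \<epsilon>) * (2 / (1 - \<theta>) * (w k * (v k)\<^sup>2 + w (Suc k) * (v (Suc k))\<^sup>2))"
      using \<epsilon> by (simp add: mult_left_mono)
    then show ?thesis
      by (simp only: D_def times_divide_eq_left times_divide_eq_right ac_simps)
  qed
  define E where "E = 2 * D * (nrm v)\<^sup>2 / (1 - q)"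
  have E0: "0 \<le> E" using D0 q by (simp add: E_def)
  have sum_bound: "(\<Sum>k\<le>N. ?\<rho> k * (?Q k)\<^sup>2) \<le> E" for N
  proof -
    let ?s = "\<lambda>N. \<Sum>k\<le>N. ?\<rho> k * (?Q k)\<^sup>2"
    have s0: "0 \<le> ?s N" for N by (intro sum_nonneg) (simp add: \<rho>_nonneg)
    have "?s N \<le> ?s (Suc N)" by (simp add: \<rho>_nonneg)
    also have "?s (Suc N) = (\<Sum>k\<le>N. ?\<rho> (Suc k) * (?Q (Suc k))\<^sup>2)" by (subst sum.atMost_Suc_shift) simp
    also have "\<dots> \<le> (\<Sum>k\<le>N. q * (?\<rho> k * (?Q k)\<^sup>2) + D * (w k * (v k)\<^sup>2 + w (Suc k) * (v (Suc k))\<^sup>2))"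
      by (intro sum_mono rec)
    also have "\<dots> = q * ?s N + D * ((\<Sum>k\<le>N. w k * (v k)\<^sup>2) + (\<Sum>k\<le>N. w (Suc k) * (v (Suc k))\<^sup>2))"
      by (simp only: sum.distrib sum_distrib_left distrib_left)
    also have "\<dots> \<le> q * ?s N + D * ((nrm v)\<^sup>2 + (nrm v)\<^sup>2)"
    proof -
      have "(\<Sum>k\<le>N. w (Suc k) * (v (Suc k))\<^sup>2) = (\<Sum>k\<in>{1..Suc N}. w k * (v k)\<^sup>2)"
        by (rule sum.reindex_bij_witness[of _ "\<lambda>k. k - 1" Suc]) auto
      then show ?thesis using sum_le_nrm_sq[OF v, of "{..N}"] sum_le_nrm_sq[OF v, of "{1..Suc N}"] D0
        by (intro add_left_mono mult_left_mono) auto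
    qed
    finally show ?thesis using q by (simp add: E_def field_simps)
  qed
  show ?thesis
  proof (rule ell2_of_bounded_sums(1))
    fix N
    have "(\<Sum>k<N. w k * (?Q k)\<^sup>2) \<le> (\<Sum>k<N. ?\<rho> k * (?Q k)\<^sup>2)"
      using step \<rho>_nonneg by (intro sum_mono mult_right_mono) (simp_all add: le_diff_eq)
    also have "\<dots> \<le> (\<Sum>k\<le>N. ?\<rho> k * (?Q k)\<^sup>2)" by (intro sum_mono2) (auto simp: \<rho>_nonneg)
    also have "\<dots> \<le> (sqrt E)\<^sup>2" using sum_bound E0 by simp
    finally show "(\<Sum>k<N. w k * (?Q k)\<^sup>2) \<le> (sqrt E)\<^sup>2" .
  qed (use E0 in simp)
qed

text \<open>
  The indicator of \<open>k\<close> jumps up at \<open>k\<close>, which \<open>S\<close> keeps, and down at \<open>Suc k\<close>, which \<open>S\<close> drops. Its jump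
  part is the indicator of \<open>{k..}\<close>, with squared norm \<open>tail_sum w k\<close>.
\<close>

lemma tail_ratio_of_jump_part_bounded:
  assumes C: "0 \<le> C" "\<And>v. v \<in> ell2 \<Longrightarrow> jump_part S v \<in> ell2"
     "\<And>v. v \<in> ell2 \<Longrightarrow> nrm (jump_part S v) \<le> C * nrm v"
    and k: "0 < k" "k \<in> S" "Suc k \<notin> S"
  shows "tail_sum w k \<le> C\<^sup>2 * w k"
proof -
  define v where "v j = (if j = k then 1 else 0 :: real)" for j
  have v0: "v j = 0" if "Suc k \<le> j" for j using that by (simp add: v_def)
  note v = ell2_of_finite_support[of "Suc k" v, OF v0]
  have "(\<Sum>j<k. w j * (v j)\<^sup>2) = 0" by (rule sum.neutral) (simp add: v_def)
  then have v2: "(nrm v)\<^sup>2 = w k" using v(2) by (simp add: v_def)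
  have Q: "jump_part S v j = (if k \<le> j then 1 else 0)" for j
  proof (induction j)
    case (Suc j)
    have "k = Suc j \<or> Suc j < k \<or> k = j \<or> k < j" by linarith
    then show ?case using k Suc by (auto simp: jump_part_Suc v_def)
  qed (use k in auto)
  have "tail_sum w k = (\<Sum>j. w j * (jump_part S v j)\<^sup>2)"
  proof -
    have s: "summable (\<lambda>j. w j * (jump_part S v j)\<^sup>2)" using C(2)[OF v(1)] by (simp add: ell2_def)
    show ?thesis unfolding suminf_split_initial_segment[OF s, of k] by (simp add: tail_sum_def Q)
  qed
  also have "\<dots> = (nrm (jump_part S v))\<^sup>2" by (simp add: nrm_sq C(2) v(1))
  also have "\<dots> \<le> (C * nrm v)\<^sup>2" by (intro power_mono C(3) v(1) nrm_nonneg)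
  also have "\<dots> = C\<^sup>2 * w k" by (simp add: power_mult_distrib v2)
  finally show ?thesis .
qed

end

section \<open>Square integrable functions on the positive integers\<close>

locale atomic_naturals = prob_space M for M :: "nat measure" +
  assumes space_M: "space M = {1..}" and sets_M: "sets M = Pow {1..}"
    and atom_pos: "1 \<le> k \<Longrightarrow> 0 < measure M {k}"
begin

definition w :: "nat \<Rightarrow> real" where "w k = measure M {Suc k}"

lemma range_Suc_eq: "range Suc = {1..}"
  by (auto simp: image_iff Suc_le_eq gr0_conv_Suc)

lemma w_sums_1: "w sums 1"
proof -
  have "(\<lambda>k. measure M {Suc k}) sums measure M (\<Union>k. {Suc k})"
    by (rule finite_measure_UNION) (auto simp: sets_M disjoint_family_on_def)
  moreover have "(\<Union>k. {Suc k}) = space M" using range_Suc_eq by (simp add: space_M UNION_singleton_eq_range)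
  ultimately show ?thesis by (simp add: w_def[abs_def] prob_space)
qed

sublocale positive_weights w
  by unfold_locales (simp_all add: w_def[symmetric] w_sums_1 atom_pos[of "Suc _", folded w_def])

lemma measurable_M [measurable]: "f \<in> borel_measurable M"
  by (rule measurableI) (auto simp: sets_M space_M)

text \<open>
  Index \<open>k\<close> stands for the point \<open>Suc k\<close>. Integrals over \<open>M\<close> become sums by transporting a density with
  respect to counting measure along \<open>Suc\<close>.
\<close>

lemma M_eq: "M = distr (density (count_space UNIV) (\<lambda>k. ennreal (w k))) M Suc"
proof (rule measure_eqI_countable[of _ "{1..}"])
  show "countable {1::nat..}" by simp
  fix a :: nat assume a: "a \<in> {1..}"
  then obtain k where k: "a = Suc k" by (cases a) auto
  let ?N = "density (count_space UNIV) (\<lambda>k. ennreal (w k))"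
  have "emeasure (distr ?N M Suc) {a} = emeasure ?N (Suc -` {a} \<inter> space ?N)"
    by (rule emeasure_distr) (use a in \<open>auto simp: sets_M space_M measurable_def\<close>)
  also have "Suc -` {a} \<inter> space ?N = {k}" using k by auto
  also have "emeasure ?N {k} = (\<integral>\<^sup>+j. ennreal (w j) * indicator {k} j \<partial>count_space UNIV)"
    by (rule emeasure_density) auto
  also have "\<dots> = ennreal (w k) * emeasure (count_space UNIV) {k}"
    by (rule nn_integral_indicator_singleton) simp
  also have "\<dots> = ennreal (w k)" by simp
  finally have "emeasure (distr ?N M Suc) {a} = ennreal (w k)" .
  then show "emeasure M {a} = emeasure (distr (density (count_space UNIV) (\<lambda>k. ennreal (w k))) M Suc) {a}"
    by (simp add: k w_def emeasure_eq_measure)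
qed (auto simp: sets_M)

lemma Suc_measurable: "Suc \<in> measurable (density (count_space UNIV) g) M"
  by (auto simp: measurable_def space_M)

lemma integrable_M_iff:
  fixes f :: "nat \<Rightarrow> 'b::{banach, second_countable_topology}"
  shows "integrable M f \<longleftrightarrow> summable (\<lambda>k. norm (w k *\<^sub>R f (Suc k)))"
proof -
  have "integrable M f \<longleftrightarrow> integrable (density (count_space UNIV) (\<lambda>k. ennreal (w k))) (\<lambda>k. f (Suc k))"
    by (subst M_eq, rule integrable_distr_eq[OF Suc_measurable measurable_M])
  also have "\<dots> \<longleftrightarrow> integrable (count_space UNIV) (\<lambda>k. w k *\<^sub>R f (Suc k))"
    by (rule integrable_density) (auto simp: w_nonneg)
  finally show ?thesis by (simp only: integrable_count_space_nat_iff)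
qed

lemma integral_M:
  fixes f :: "nat \<Rightarrow> 'b::{banach, second_countable_topology}"
  assumes "integrable M f"
  shows "integral\<^sup>L M f = (\<Sum>k. w k *\<^sub>R f (Suc k))"
proof -
  have "integral\<^sup>L M f = integral\<^sup>L (density (count_space UNIV) (\<lambda>k. ennreal (w k))) (\<lambda>k. f (Suc k))"
    by (subst M_eq, rule integral_distr[OF Suc_measurable measurable_M])
  also have "\<dots> = integral\<^sup>L (count_space UNIV) (\<lambda>k. w k *\<^sub>R f (Suc k))"
    by (rule integral_density) (auto simp: w_nonneg)
  also have "\<dots> = (\<Sum>k. w k *\<^sub>R f (Suc k))"
    by (rule integral_count_space_nat) (use assms in \<open>simp only: integrable_M_iff integrable_count_space_nat_iff\<close>)
  finally show ?thesis .
qed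

lemma AE_M_iff: "(AE \<omega> in M. P \<omega>) \<longleftrightarrow> (\<forall>k. P (Suc k))"
proof
  assume "AE \<omega> in M. P \<omega>"
  then have "{\<omega> \<in> space M. \<not> P \<omega>} \<in> null_sets M"
    by (subst (asm) AE_iff_null) (auto simp: sets_M space_M)
  then have null: "measure M {\<omega> \<in> space M. \<not> P \<omega>} = 0" by (simp add: measure_eq_0_null_sets)
  show "\<forall>k. P (Suc k)"
  proof (rule allI, rule ccontr)
    fix k assume "\<not> P (Suc k)"
    then have "measure M {Suc k} \<le> measure M {\<omega> \<in> space M. \<not> P \<omega>}"
      by (intro finite_measure_mono) (auto simp: sets_M space_M)
    then show False using null atom_pos[of "Suc k"] by simp
  qed
next
  assume P: "\<forall>k. P (Suc k)"
  show "AE \<omega> in M. P \<omega>"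
  proof (rule AE_I2)
    fix \<omega> assume "\<omega> \<in> space M"
    then obtain k where "\<omega> = Suc k" by (cases \<omega>) (auto simp: space_M)
    then show "P \<omega>" using P by simp
  qed
qed

definition cell2 :: "(nat \<Rightarrow> complex) set" where
  "cell2 = {x. (\<lambda>k. cmod (x k)) \<in> ell2}"

lemma cell2_iff: "x \<in> cell2 \<longleftrightarrow> (\<lambda>k. Re (x k)) \<in> ell2 \<and> (\<lambda>k. Im (x k)) \<in> ell2"
proof
  assume x: "x \<in> cell2"
  then have s: "summable (\<lambda>k. w k * (cmod (x k))\<^sup>2)" by (simp add: cell2_def ell2_def)
  have "summable (\<lambda>k. w k * (Re (x k))\<^sup>2)" "summable (\<lambda>k. w k * (Im (x k))\<^sup>2)"
    by (rule summable_comparison_test'[OF s, of 0],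
        simp add: w_nonneg cmod_power2 mult_left_mono)+
  then show "(\<lambda>k. Re (x k)) \<in> ell2 \<and> (\<lambda>k. Im (x k)) \<in> ell2" by (simp add: ell2_def)
next
  assume "(\<lambda>k. Re (x k)) \<in> ell2 \<and> (\<lambda>k. Im (x k)) \<in> ell2"
  then have "summable (\<lambda>k. w k * (Re (x k))\<^sup>2 + w k * (Im (x k))\<^sup>2)"
    by (intro summable_add) (auto simp: ell2_def)
  then show "x \<in> cell2" by (simp add: cell2_def ell2_def cmod_power2 distrib_left)
qed

lemma cell2_const: "(\<lambda>_. c) \<in> cell2" by (simp add: cell2_iff ell2_const)

lemma cell2_add: "x \<in> cell2 \<Longrightarrow> y \<in> cell2 \<Longrightarrow> (\<lambda>k. x k + y k) \<in> cell2"
  by (auto simp: cell2_iff ell2_add(1))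

lemma cell2_diff: "x \<in> cell2 \<Longrightarrow> y \<in> cell2 \<Longrightarrow> (\<lambda>k. x k - y k) \<in> cell2"
  by (auto simp: cell2_iff ell2_diff(1))

lemma cell2_sum: "finite I \<Longrightarrow> (\<And>i. i \<in> I \<Longrightarrow> x i \<in> cell2) \<Longrightarrow> (\<lambda>k. \<Sum>i\<in>I. x i k) \<in> cell2"
  by (induction I rule: finite_induct) (auto simp: cell2_const cell2_add)

lemma cell2_summable_norm: "x \<in> cell2 \<Longrightarrow> summable (\<lambda>k. norm (w k *\<^sub>R x k))"
  using ell2_summable_abs(1)[of "\<lambda>k. cmod (x k)"] by (simp add: cell2_def abs_mult)

lemma cell2_summable: "x \<in> cell2 \<Longrightarrow> summable (\<lambda>k. w k *\<^sub>R x k)"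
  by (rule summable_norm_cancel[OF cell2_summable_norm])

lemma cell2_mult_summable_norm:
  "x \<in> cell2 \<Longrightarrow> y \<in> cell2 \<Longrightarrow> summable (\<lambda>k. norm (w k *\<^sub>R (x k * y k)))"
  using ell2_mult(1)[of "\<lambda>k. cmod (x k)" "\<lambda>k. cmod (y k)"]
  by (simp add: cell2_def abs_mult norm_mult mult.assoc)

lemma cell2_norm_suminf_le:
  assumes "x \<in> cell2" shows "norm (\<Sum>k. w k *\<^sub>R x k) \<le> nrm (\<lambda>k. cmod (x k))"
proof -
  have "norm (\<Sum>k. w k *\<^sub>R x k) \<le> (\<Sum>k. norm (w k *\<^sub>R x k))"
    by (rule summable_norm[OF cell2_summable_norm[OF assms]])
  also have "\<dots> = (\<Sum>k. \<bar>w k * cmod (x k)\<bar>)" by (simp add: abs_mult)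
  also have "\<dots> \<le> nrm (\<lambda>k. cmod (x k))"
    using assms by (intro ell2_summable_abs(2)) (simp add: cell2_def)
  finally show ?thesis .
qed

definition tails :: "(nat \<Rightarrow> complex) \<Rightarrow> nat \<Rightarrow> complex" where
  "tails x = tail_sum (\<lambda>k. w k *\<^sub>R x k)"

lemma tails_add: "x \<in> cell2 \<Longrightarrow> y \<in> cell2 \<Longrightarrow> tails (\<lambda>k. x k + y k) k = tails x k + tails y k"
  unfolding tails_def scaleR_add_right by (rule tail_sum_add) (rule cell2_summable, assumption)+

lemma tails_diff: assumes "x \<in> cell2" "y \<in> cell2"
  shows "tails (\<lambda>k. x k - y k) k = tails x k - tails y k"
  using tails_add[OF cell2_diff[OF assms] assms(2), of k] by simp

lemma tails_sum: "finite I \<Longrightarrow> (\<And>i. i \<in> I \<Longrightarrow> x i \<in> cell2) \<Longrightarrow>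
    tails (\<lambda>j. \<Sum>i\<in>I. x i j) k = (\<Sum>i\<in>I. tails (x i) k)"
proof (induction I rule: finite_induct)
  case empty show ?case by (simp add: tails_def tail_sum_def)
next
  case (insert i I) then show ?case by (simp add: tails_add cell2_sum)
qed

lemma w_tail_0: "tail_sum w 0 = 1"
  using w_sums_1 by (simp add: tail_sum_0 sums_iff)

lemma tails_const: "tails (\<lambda>_. c) k = tail_sum w k *\<^sub>R c"
proof -
  have "summable (\<lambda>j. w (j + k))" using w_summable summable_iff_shift[of w k] by simp
  then have "(\<lambda>j. w (j + k) *\<^sub>R c) sums (tail_sum w k *\<^sub>R c)"
    unfolding tail_sum_def by (intro sums_scaleR_left summable_sums)
  then show ?thesis by (simp add: tails_def tail_sum_def sums_iff)
qed

lemma tails_0_const: "tails (\<lambda>_. c) 0 = c"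
  by (simp add: tails_const w_tail_0)

lemma Re_tails: assumes "x \<in> cell2" shows "Re (tails x k) = tail_sum (\<lambda>k. w k * Re (x k)) k"
proof -
  have "summable (\<lambda>j. w (j + k) *\<^sub>R x (j + k))"
    using cell2_summable[OF assms] summable_iff_shift[of "\<lambda>j. w j *\<^sub>R x j" k] by simp
  then show ?thesis by (simp add: tails_def tail_sum_def Re_suminf)
qed

lemma Im_tails: assumes "x \<in> cell2" shows "Im (tails x k) = tail_sum (\<lambda>k. w k * Im (x k)) k"
proof -
  have "summable (\<lambda>j. w (j + k) *\<^sub>R x (j + k))"
    using cell2_summable[OF assms] summable_iff_shift[of "\<lambda>j. w j *\<^sub>R x j" k] by simp
  then show ?thesis by (simp add: tails_def tail_sum_def Im_suminf)
qed

lemma cell2_jump_part: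
  assumes "\<And>v. v \<in> ell2 \<Longrightarrow> jump_part S v \<in> ell2" "x \<in> cell2"
  shows "jump_part S x \<in> cell2"
proof -
  have "Re (jump_part S x k) = jump_part S (\<lambda>k. Re (x k)) k"
    "Im (jump_part S x k) = jump_part S (\<lambda>k. Im (x k)) k" for k
    by (simp_all add: jump_part_def)
  then have "(\<lambda>k. Re (jump_part S x k)) = jump_part S (\<lambda>k. Re (x k))"
    "(\<lambda>k. Im (jump_part S x k)) = jump_part S (\<lambda>k. Im (x k))" by auto
  then show ?thesis using assms by (simp add: cell2_iff)
qed

lemma Re_Im_jump_adjoint:
  assumes "x \<in> cell2"
  shows "Re (jump_adjoint w S x k) = jump_adjoint w S (\<lambda>k. Re (x k)) k"
    "Im (jump_adjoint w S x k) = jump_adjoint w S (\<lambda>k. Im (x k)) k"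
  using Re_tails[OF assms] Im_tails[OF assms] unfolding tails_def
  by (simp_all add: jump_adjoint_def masked_tail_def)

lemma cell2_jump_adjoint:
  assumes "0 \<notin> S" "\<And>v. v \<in> ell2 \<Longrightarrow> jump_part S v \<in> ell2" "x \<in> cell2"
  shows "jump_adjoint w S x \<in> cell2"
  unfolding cell2_iff Re_Im_jump_adjoint[OF assms(3)]
  using jump_adjoint_ell2[OF assms(1,2), of "\<lambda>k. Re (x k)"] jump_adjoint_ell2[OF assms(1,2), of "\<lambda>k. Im (x k)"]
    assms(3) by (simp add: cell2_iff)

text \<open>
  The weighted values of the adjoint are differences of consecutive masked tails, so their sum
  telescopes; the masked tails tend to zero.
\<close>

lemma tails_jump_adjoint:
  assumes "0 \<notin> S" "x \<in> cell2"
  shows "tails (jump_adjoint w S x) k = (if k \<in> S then tails x k else 0)"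
proof -
  have t0: "(\<lambda>j. tail_sum (\<lambda>k. w k *\<^sub>R x k) j) \<longlonglongrightarrow> 0"
    by (rule tail_sum_tendsto_0[OF cell2_summable[OF assms(2)]])
  have "masked_tail w S x \<longlonglongrightarrow> 0"
    by (rule Lim_null_comparison[OF _ tendsto_norm_zero[OF t0]])
      (auto simp: masked_tail_def intro!: always_eventually)
  then have "(\<lambda>j. masked_tail w S x (j + k)) \<longlonglongrightarrow> 0" by (rule LIMSEQ_ignore_initial_segment)
  from telescope_sums'[OF this]
  have "(\<lambda>j. masked_tail w S x (j + k) - masked_tail w S x (Suc j + k)) sums masked_tail w S x k" by simp
  then have "tails (jump_adjoint w S x) k = masked_tail w S x k"
    unfolding tails_def tail_sum_def weight_jump_adjoint by (simp add: sums_iff)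
  then show ?thesis by (simp add: masked_tail_def tails_def)
qed

lemma integral_eq_tails: "(\<lambda>k. f (Suc k)) \<in> cell2 \<Longrightarrow> integral\<^sup>L M f = tails (\<lambda>k. f (Suc k)) 0"
  unfolding tails_def tail_sum_0 by (rule integral_M) (simp only: integrable_M_iff cell2_summable_norm)

lemma integrable_cell2: "(\<lambda>k. f (Suc k)) \<in> cell2 \<Longrightarrow> integrable M f"
  by (simp only: integrable_M_iff cell2_summable_norm)

lemma integrable_sq_iff: "integrable M (\<lambda>\<omega>. (cmod (f \<omega>))\<^sup>2) \<longleftrightarrow> (\<lambda>k. f (Suc k)) \<in> cell2"
  by (simp add: integrable_M_iff cell2_def ell2_def abs_mult abs_of_nonneg[OF w_nonneg])

lemma L2_inner_eq: assumes "(\<lambda>k. f (Suc k)) \<in> cell2" "(\<lambda>k. g (Suc k)) \<in> cell2"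
  shows "L2_inner M f g = (\<Sum>k. w k *\<^sub>R (f (Suc k) * cnj (g (Suc k))))"
proof -
  have "(\<lambda>k. cnj (g (Suc k))) \<in> cell2" using assms(2) by (simp add: cell2_def)
  from cell2_mult_summable_norm[OF assms(1) this]
  show ?thesis unfolding L2_inner_def by (intro integral_M) (simp only: integrable_M_iff)
qed

lemma L2_norm_eq: assumes "(\<lambda>k. f (Suc k)) \<in> cell2"
  shows "L2_norm M f = nrm (\<lambda>k. cmod (f (Suc k)))"
proof -
  have "(\<integral>\<omega>. (cmod (f \<omega>))\<^sup>2 \<partial>M) = (\<Sum>k. w k * (cmod (f (Suc k)))\<^sup>2)"
    using integral_M[of "\<lambda>\<omega>. (cmod (f \<omega>))\<^sup>2"] assms by (simp add: integrable_sq_iff)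
  also have "\<dots> = (nrm (\<lambda>k. cmod (f (Suc k))))\<^sup>2"
    by (rule nrm_sq[symmetric]) (use assms in \<open>simp add: cell2_def\<close>)
  finally show ?thesis by (simp add: L2_norm_def nrm_nonneg)
qed

end


section \<open>Functions measurable with respect to a partition into intervals\<close>

lemma enumerate_no_between:
  fixes A :: "nat set"
  assumes A: "infinite A" and j: "enumerate A m < j" "j < enumerate A (Suc m)"
  shows "j \<notin> A"
proof
  assume "j \<in> A"
  then obtain l where l: "enumerate A l = j" using enumerate_Ex[OF A] by blast
  have "m < l" "l < Suc m" using j A unfolding l[symmetric] by (simp_all add: enumerate_mono_iff)
  then show False by simp
qed

lemma less_enumerate_0_notin:
  fixes A :: "nat set"
  assumes A: "infinite A" and j: "j < enumerate A 0" shows "j \<notin> A"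
  using j by (auto simp: enumerate_0 dest: not_less_Least)

locale infinite_breakpoints =
  fixes A :: "nat set" assumes A_inf: "infinite A" and A_ge: "A \<subseteq> {2..}"
begin

lemma enumerate_ge: "2 \<le> enumerate A m"
  using enumerate_in_set[OF A_inf, of m] A_ge by auto

lemma space_sigma_a: "space (sigma_a A) = {1..}" and sets_sigma_a: "sets (sigma_a A) = sigma_sets {1..} (part A)"
proof -
  have ge_1: "1 \<le> enumerate A m" for m using enumerate_ge[of m] by simp
  have "part A \<subseteq> Pow {1..}" unfolding part_def using le_trans[OF ge_1] by fastforce
  then show "space (sigma_a A) = {1..}" "sets (sigma_a A) = sigma_sets {1..} (part A)"
    by (simp_all add: sigma_a_def)
qed

text \<open>
  The two points \<open>k\<close> and \<open>Suc k\<close> lie in the same block of the partition unless a new block starts at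
  \<open>Suc k\<close>, and complements and countable unions inherit this.
\<close>

lemma sigma_a_saturated:
  assumes "X \<in> sets (sigma_a A)" "1 \<le> k" "Suc k \<notin> A"
  shows "Suc k \<in> X \<longleftrightarrow> k \<in> X"
  using assms(1) unfolding sets_sigma_a
proof (induction rule: sigma_sets.induct)
  case (Basic X)
  have e: "enumerate A m \<noteq> Suc k" for m using enumerate_in_set[OF A_inf, of m] assms(3) by auto
  have lt: "Suc k < enumerate A m \<longleftrightarrow> k < enumerate A m" for m
    using e[of m] by (metis Suc_lessD Suc_lessI)
  have le: "enumerate A m \<le> Suc k \<longleftrightarrow> enumerate A m \<le> k" for m
    using e[of m] by (metis le_Suc_eq)
  consider "X = {1..<enumerate A 0}" | m where "X = {enumerate A m..<enumerate A (Suc m)}"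
    using Basic by (auto simp: part_def)
  then show ?case
  proof cases
    case 1 show ?thesis unfolding 1 atLeastLessThan_iff lt using assms(2) by simp
  next
    case 2 show ?thesis unfolding 2 atLeastLessThan_iff lt le ..
  qed
qed (use assms(2) in auto)

lemma exists_block: "1 \<le> k \<Longrightarrow> \<exists>a b. k \<in> {a..<b} \<and> {a..<b} \<in> part A \<and> 1 \<le> a \<and> (\<forall>j. a < j \<longrightarrow> j < b \<longrightarrow> j \<notin> A)"
proof (cases "k < enumerate A 0")
  case True
  assume "1 \<le> k"
  then have "k \<in> {1..<enumerate A 0}" using True by simp
  moreover have "{1..<enumerate A 0} \<in> part A" by (simp add: part_def)
  ultimately show ?thesis using less_enumerate_0_notin[OF A_inf] by blast
next
  case False
  define m where "m = (LEAST m. k < enumerate A m)"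
  have "k < enumerate A (Suc k)" using le_enumerate[OF A_inf, of "Suc k"] by simp
  then have m: "k < enumerate A m" unfolding m_def by (rule LeastI)
  then obtain l where l: "m = Suc l" using False by (cases m) auto
  have "\<not> k < enumerate A l" using not_less_Least[of l "\<lambda>m. k < enumerate A m"] l m_def by auto
  then have "k \<in> {enumerate A l..<enumerate A (Suc l)}" using m l by simp
  moreover have "{enumerate A l..<enumerate A (Suc l)} \<in> part A" by (simp add: part_def)
  moreover have "1 \<le> enumerate A l" using enumerate_ge[of l] by simp
  ultimately show ?thesis using enumerate_no_between[OF A_inf, of l] by blast
qed

lemma sets_sigma_aI:
  assumes X: "X \<subseteq> {1..}" and sat: "\<And>k. 1 \<le> k \<Longrightarrow> Suc k \<notin> A \<Longrightarrow> Suc k \<in> X \<longleftrightarrow> k \<in> X"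
  shows "X \<in> sets (sigma_a A)"
proof -
  have eq: "\<Union>{b \<in> part A. b \<subseteq> X} = X"
  proof (intro equalityI subsetI)
    fix k assume k: "k \<in> X"
    then have "1 \<le> k" using X by auto
    then obtain a b where ab: "k \<in> {a..<b}" "{a..<b} \<in> part A" "1 \<le> a" "\<forall>j. a < j \<longrightarrow> j < b \<longrightarrow> j \<notin> A"
      using exists_block by blast
    have a: "j \<in> X \<longleftrightarrow> a \<in> X" if "a \<le> j" "j < b" for j
      using that
    proof (induction j rule: dec_induct)
      case (step j)
      have "Suc j \<notin> A" "1 \<le> j" "j < b" using step ab(3,4) by auto
      then show ?case using sat[of j] step by simp
    qed simp
    have "a \<in> X" using a[of k] k ab(1) by simp
    then have "{a..<b} \<subseteq> X" using a by (auto simp only: atLeastLessThan_iff)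
    then show "k \<in> \<Union>{b \<in> part A. b \<subseteq> X}" using ab(1,2) by blast
  qed blast
  have "\<Union>{b \<in> part A. b \<subseteq> X} \<in> sets (sigma_a A)"
  proof (rule sets.countable_Union)
    have "countable (part A)" by (simp add: part_def)
    then show "countable {b \<in> part A. b \<subseteq> X}" by (rule countable_subset[rotated]) auto
    show "{b \<in> part A. b \<subseteq> X} \<subseteq> sets (sigma_a A)"
      unfolding sets_sigma_a by (auto intro: sigma_sets.Basic)
  qed
  then show ?thesis by (simp only: eq)
qed

lemma measurable_sigma_a_iff:
  fixes f :: "nat \<Rightarrow> complex"
  shows "f \<in> borel_measurable (sigma_a A) \<longleftrightarrow> (\<forall>k. Suc (Suc k) \<notin> A \<longrightarrow> f (Suc (Suc k)) = f (Suc k))"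
proof
  assume f: "f \<in> borel_measurable (sigma_a A)"
  show "\<forall>k. Suc (Suc k) \<notin> A \<longrightarrow> f (Suc (Suc k)) = f (Suc k)"
  proof (intro allI impI)
    fix k assume k: "Suc (Suc k) \<notin> A"
    have "f -` {f (Suc k)} \<inter> space (sigma_a A) \<in> sets (sigma_a A)"
      by (rule measurable_sets[OF f]) simp
    from sigma_a_saturated[OF this _ k] show "f (Suc (Suc k)) = f (Suc k)" by (simp add: space_sigma_a)
  qed
next
  assume f: "\<forall>k. Suc (Suc k) \<notin> A \<longrightarrow> f (Suc (Suc k)) = f (Suc k)"
  show "f \<in> borel_measurable (sigma_a A)"
  proof (rule measurableI)
    fix B :: "complex set"
    show "f -` B \<inter> space (sigma_a A) \<in> sets (sigma_a A)"
    proof (rule sets_sigma_aI)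
      fix k :: nat assume k: "1 \<le> k" "Suc k \<notin> A"
      then obtain l where "k = Suc l" by (cases k) auto
      then show "Suc k \<in> f -` B \<inter> space (sigma_a A) \<longleftrightarrow> k \<in> f -` B \<inter> space (sigma_a A)"
        using f k by (simp add: space_sigma_a)
    qed (auto simp: space_sigma_a)
  qed simp
qed

end

section \<open>Conditional expectations and projections in terms of tails\<close>

lemma complex_cond_exp_eq_iff:
  fixes f g :: "'a \<Rightarrow> complex"
  assumes F: "sigma_finite_subalgebra M F" and f: "integrable M f" and g: "integrable M g" "g \<in> borel_measurable F"
  shows "(AE \<omega> in M. complex_cond_exp M F f \<omega> = g \<omega>) \<longleftrightarrow>
    (\<forall>X\<in>sets F. (\<integral>\<omega>\<in>X. f \<omega> \<partial>M) = (\<integral>\<omega>\<in>X. g \<omega> \<partial>M))"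
proof -
  interpret sigma_finite_subalgebra M F by (rule F)
  have gm: "(\<lambda>\<omega>. Re (g \<omega>)) \<in> borel_measurable F" "(\<lambda>\<omega>. Im (g \<omega>)) \<in> borel_measurable F" using g(2) by measurable
  have ReIm: "Re (\<integral>\<omega>\<in>X. h \<omega> \<partial>M) = (\<integral>\<omega>\<in>X. Re (h \<omega>) \<partial>M)" "Im (\<integral>\<omega>\<in>X. h \<omega> \<partial>M) = (\<integral>\<omega>\<in>X. Im (h \<omega>) \<partial>M)"
    if X: "X \<in> sets F" and h: "integrable M h" for X and h :: "'a \<Rightarrow> complex"
  proof -
    have "X \<in> sets M" using X subalg by (auto simp: subalgebra_def)
    then have "integrable M (\<lambda>\<omega>. indicator X \<omega> *\<^sub>R h \<omega>)" by (rule integrable_mult_indicator[OF _ h])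
    then show "Re (\<integral>\<omega>\<in>X. h \<omega> \<partial>M) = (\<integral>\<omega>\<in>X. Re (h \<omega>) \<partial>M)" "Im (\<integral>\<omega>\<in>X. h \<omega> \<partial>M) = (\<integral>\<omega>\<in>X. Im (h \<omega>) \<partial>M)"
      unfolding set_lebesgue_integral_def by (simp_all flip: integral_Re integral_Im)
  qed
  have split: "(AE \<omega> in M. complex_cond_exp M F f \<omega> = g \<omega>) \<longleftrightarrow>
      (AE \<omega> in M. real_cond_exp M F (\<lambda>\<omega>. Re (f \<omega>)) \<omega> = Re (g \<omega>)) \<and>
      (AE \<omega> in M. real_cond_exp M F (\<lambda>\<omega>. Im (f \<omega>)) \<omega> = Im (g \<omega>))"
    by (simp add: complex_cond_exp_def complex_eq_iff AE_conj_iff)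
  have real: "(AE \<omega> in M. real_cond_exp M F u \<omega> = v \<omega>) \<longleftrightarrow>
      (\<forall>X\<in>sets F. (\<integral>\<omega>\<in>X. u \<omega> \<partial>M) = (\<integral>\<omega>\<in>X. v \<omega> \<partial>M))"
    if u: "integrable M u" and v: "integrable M v" "v \<in> borel_measurable F" for u v :: "'a \<Rightarrow> real"
  proof
    assume ae: "AE \<omega> in M. real_cond_exp M F u \<omega> = v \<omega>"
    show "\<forall>X\<in>sets F. (\<integral>\<omega>\<in>X. u \<omega> \<partial>M) = (\<integral>\<omega>\<in>X. v \<omega> \<partial>M)"
    proof
      fix X assume X: "X \<in> sets F"
      then have XM: "X \<in> sets M" using subalg by (auto simp: subalgebra_def)
      have "(\<integral>\<omega>\<in>X. u \<omega> \<partial>M) = (\<integral>\<omega>\<in>X. real_cond_exp M F u \<omega> \<partial>M)" by (rule real_cond_exp_intA[OF u X])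
      also have "\<dots> = (\<integral>\<omega>\<in>X. v \<omega> \<partial>M)" unfolding set_lebesgue_integral_def
        by (rule integral_cong_AE) (use ae XM v(1) in \<open>auto intro!: borel_measurable_scaleR borel_measurable_indicator\<close>)
      finally show "(\<integral>\<omega>\<in>X. u \<omega> \<partial>M) = (\<integral>\<omega>\<in>X. v \<omega> \<partial>M)" .
    qed
  next
    assume "\<forall>X\<in>sets F. (\<integral>\<omega>\<in>X. u \<omega> \<partial>M) = (\<integral>\<omega>\<in>X. v \<omega> \<partial>M)"
    then show "AE \<omega> in M. real_cond_exp M F u \<omega> = v \<omega>" by (intro real_cond_exp_charact u v) blast
  qed
  show ?thesis
    unfolding split real[OF integrable_Re[OF f] integrable_Re[OF g(1)] gm(1)] real[OF integrable_Im[OF f] integrable_Im[OF g(1)] gm(2)]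
    using ReIm[OF _ f] ReIm[OF _ g(1)] by (auto simp: complex_eq_iff)
qed

locale partitioned_naturals = atomic_naturals M for M :: "nat measure" +
  fixes K :: "complex set" and n :: nat and A :: "nat \<Rightarrow> nat set"
  assumes K: "K = \<real> \<or> K = UNIV"
    and A_Union: "(\<Union>i\<in>{1..n}. A i) = {1..} - {1}"
    and A_disjoint: "disjoint_family_on A {1..n}"
    and A_infinite: "i \<in> {1..n} \<Longrightarrow> infinite (A i)"
begin

abbreviation H :: "nat \<Rightarrow> (nat \<Rightarrow> complex) set" where
  "H i \<equiv> L2_0 K M (sigma_a (A i))"

text \<open>
  The indices at which a function measurable with respect to \<open>sigma_a (A i)\<close> may jump; index \<open>k\<close>
  stands for the point \<open>Suc k\<close>.
\<close>

definition J :: "nat \<Rightarrow> nat set" where "J i = {k. Suc k \<in> A i}"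

lemma A_ge: assumes "i \<in> {1..n}" shows "A i \<subseteq> {2..}"
proof
  fix a assume "a \<in> A i"
  then have "a \<in> (\<Union>i\<in>{1..n}. A i)" using assms by blast
  then show "a \<in> {2..}" unfolding A_Union by simp
qed

lemma breakpoints: "i \<in> {1..n} \<Longrightarrow> infinite_breakpoints (A i)"
  by (rule infinite_breakpoints.intro[OF A_infinite A_ge])

lemma zero_notin_J: assumes "i \<in> {1..n}" shows "0 \<notin> J i"
proof
  assume "0 \<in> J i"
  then have "Suc 0 \<in> A i" by (simp add: J_def)
  then show False using A_ge[OF assms] by auto
qed

lemma J_cover: "0 < k \<Longrightarrow> \<exists>i\<in>{1..n}. k \<in> J i"
proof -
  assume "0 < k"
  then have "Suc k \<in> (\<Union>i\<in>{1..n}. A i)" unfolding A_Union by simp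
  then show ?thesis by (simp add: J_def)
qed

lemma J_unique: "i \<in> {1..n} \<Longrightarrow> j \<in> {1..n} \<Longrightarrow> k \<in> J i \<Longrightarrow> k \<in> J j \<Longrightarrow> i = j"
  using A_disjoint unfolding disjoint_family_on_def J_def by blast

lemma mem_J_iff: "i \<in> {1..n} \<Longrightarrow> j \<in> {1..n} \<Longrightarrow> k \<in> J i \<Longrightarrow> k \<in> J j \<longleftrightarrow> j = i"
  using J_unique by blast

lemma J_infinite: assumes "i \<in> {1..n}" shows "infinite (J i)"
proof
  assume "finite (J i)"
  moreover have "A i \<subseteq> Suc ` J i"
  proof
    fix a assume "a \<in> A i"
    then show "a \<in> Suc ` J i" using A_ge[OF assms] by (cases a) (auto simp: J_def)
  qed
  ultimately show False using A_infinite[OF assms] finite_subset by blast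
qed

lemma n_pos: "1 \<in> {1..n}"
  using J_cover[of 1] by auto

lemma K_iff: "c \<in> K \<longleftrightarrow> K = UNIV \<or> Im c = 0"
  using K complex_is_Real_iff[of c] by auto

lemma ball_space: "(\<forall>\<omega>\<in>space M. P \<omega>) \<longleftrightarrow> (\<forall>k. P (Suc k))"
  using range_Suc_eq by (metis space_M rangeE rangeI)

lemma L2_iff: "f \<in> L2 K M M \<longleftrightarrow> (\<forall>k. f (Suc k) \<in> K) \<and> (\<lambda>k. f (Suc k)) \<in> cell2"
  unfolding L2_def random_vars_def ball_space integrable_sq_iff
  by (auto intro!: bexI[of _ f] measurable_M)

lemma L2_sigma_a_iff:
  assumes i: "i \<in> {1..n}"
  shows "f \<in> L2 K M (sigma_a (A i)) \<longleftrightarrow>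
    f \<in> L2 K M M \<and> (\<forall>k. Suc k \<notin> J i \<longrightarrow> f (Suc (Suc k)) = f (Suc k))"
proof -
  interpret infinite_breakpoints "A i" by (rule breakpoints[OF i])
  have rv: "g \<in> random_vars K (sigma_a (A i)) \<longleftrightarrow>
      (\<forall>k. g (Suc k) \<in> K) \<and> (\<forall>k. Suc k \<notin> J i \<longrightarrow> g (Suc (Suc k)) = g (Suc k))" for g
    unfolding random_vars_def using ball_space[of "\<lambda>\<omega>. g \<omega> \<in> K"]
    by (auto simp: measurable_sigma_a_iff J_def space_sigma_a space_M)
  have "f \<in> L2 K M (sigma_a (A i)) \<longleftrightarrow>
      (\<forall>k. f (Suc k) \<in> K) \<and> (\<lambda>k. f (Suc k)) \<in> cell2 \<and>
      (\<exists>\<eta>\<in>random_vars K (sigma_a (A i)). \<forall>k. f (Suc k) = \<eta> (Suc k))"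
    unfolding L2_def random_vars_def[of K M] ball_space integrable_sq_iff AE_M_iff by auto
  also have "\<dots> \<longleftrightarrow> f \<in> L2 K M M \<and> (\<forall>k. Suc k \<notin> J i \<longrightarrow> f (Suc (Suc k)) = f (Suc k))"
    unfolding L2_iff by (auto simp: rv Bex_def intro!: exI[of _ f])
  finally show ?thesis .
qed

lemma L2_0_iff: "f \<in> L2_0 K M M \<longleftrightarrow> f \<in> L2 K M M \<and> tails (\<lambda>k. f (Suc k)) 0 = 0"
  unfolding L2_0_def using integral_eq_tails[of f] by (auto simp: L2_iff)

lemma H_iff: "i \<in> {1..n} \<Longrightarrow> f \<in> H i \<longleftrightarrow>
    f \<in> L2_0 K M M \<and> (\<forall>k. Suc k \<notin> J i \<longrightarrow> f (Suc (Suc k)) = f (Suc k))"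
  unfolding L2_0_def by (auto simp: L2_sigma_a_iff)

lemma L2_0I:
  assumes "\<And>k. f (Suc k) \<in> K" "(\<lambda>k. f (Suc k)) \<in> cell2" "tails (\<lambda>k. f (Suc k)) 0 = 0"
  shows "f \<in> L2_0 K M M"
  unfolding L2_0_iff L2_iff using assms by blast

lemma L2_0D:
  assumes "f \<in> L2_0 K M M"
  shows "f (Suc k) \<in> K" "(\<lambda>k. f (Suc k)) \<in> cell2" "tails (\<lambda>k. f (Suc k)) 0 = 0"
  using assms unfolding L2_0_iff L2_iff by blast+

lemma HI:
  assumes "i \<in> {1..n}" "\<And>k. f (Suc k) \<in> K" "(\<lambda>k. f (Suc k)) \<in> cell2" "tails (\<lambda>k. f (Suc k)) 0 = 0"
    "\<And>k. Suc k \<notin> J i \<Longrightarrow> f (Suc (Suc k)) = f (Suc k)"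
  shows "f \<in> H i"
  unfolding H_iff[OF assms(1)] using L2_0I[of f, OF assms(2-4)] assms(5) by blast

lemma HD:
  assumes "f \<in> H i" "i \<in> {1..n}"
  shows "f (Suc k) \<in> K" "(\<lambda>k. f (Suc k)) \<in> cell2" "tails (\<lambda>k. f (Suc k)) 0 = 0"
    "Suc k \<notin> J i \<Longrightarrow> f (Suc (Suc k)) = f (Suc k)"
proof -
  have f: "f \<in> L2_0 K M M" "\<And>k. Suc k \<notin> J i \<Longrightarrow> f (Suc (Suc k)) = f (Suc k)"
    using assms(1) unfolding H_iff[OF assms(2)] by blast+
  then show "f (Suc k) \<in> K" "(\<lambda>k. f (Suc k)) \<in> cell2" "tails (\<lambda>k. f (Suc k)) 0 = 0"
    "Suc k \<notin> J i \<Longrightarrow> f (Suc (Suc k)) = f (Suc k)"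
    using L2_0D[OF f(1)] by blast+
qed

lemma K_diff: "a \<in> K \<Longrightarrow> b \<in> K \<Longrightarrow> a - b \<in> K" by (auto simp: K_iff)

lemma K_of_real: "complex_of_real a \<in> K" by (simp add: K_iff)

lemma Im_tails_0: "x \<in> cell2 \<Longrightarrow> (\<And>k. Im (x k) = 0) \<Longrightarrow> Im (tails x k) = 0"
  by (simp add: Im_tails tail_sum_def)

lemma tails_in_K: "x \<in> cell2 \<Longrightarrow> (\<And>k. x k \<in> K) \<Longrightarrow> tails x k \<in> K"
  using Im_tails_0[of x k] by (auto simp: K_iff)

lemma center_L2_0:
  assumes "f \<in> L2 K M M"
  shows "(\<lambda>\<omega>. f \<omega> - tails (\<lambda>k. f (Suc k)) 0) \<in> L2_0 K M M"
proof -
  have f: "(\<lambda>k. f (Suc k)) \<in> cell2" "\<And>k. f (Suc k) \<in> K"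
    using assms unfolding L2_iff by blast+
  show ?thesis
  proof (rule L2_0I)
    show "f (Suc k) - tails (\<lambda>k. f (Suc k)) 0 \<in> K" for k
      by (rule K_diff[OF f(2) tails_in_K[OF f]])
    show "(\<lambda>k. f (Suc k) - tails (\<lambda>k. f (Suc k)) 0) \<in> cell2"
      by (rule cell2_diff[OF f(1) cell2_const])
    show "tails (\<lambda>k. f (Suc k) - tails (\<lambda>k. f (Suc k)) 0) 0 = 0"
      by (simp only: tails_diff[OF f(1) cell2_const] tails_0_const diff_self)
  qed
qed

text \<open>
  For the forward direction, test against the centred indicators of the tails \<open>{k..}\<close>. Conversely, all
  elements of \<open>H i\<close> jump only where the tails of \<open>y - x\<close>, after centring, vanish, so
  \<open>suminf_mult_eq_0_if_tails_vanish\<close> applies; the constant removed by centring is orthogonal to \<open>H i\<close>.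
\<close>

lemma is_orth_proj_iff:
  assumes i: "i \<in> {1..n}" and y: "y \<in> L2 K M M" and x: "x \<in> H i"
  shows "is_orth_proj (L2_inner M) (H i) y x \<longleftrightarrow>
    (\<forall>k\<in>J i. tails (\<lambda>j. y (Suc j) - tails (\<lambda>j. y (Suc j)) 0) k = tails (\<lambda>j. x (Suc j)) k)"
proof -
  define z where "z j = y (Suc j) - x (Suc j)" for j
  define m where "m = tails (\<lambda>j. y (Suc j)) 0"
  have y2: "(\<lambda>j. y (Suc j)) \<in> cell2" and x2: "(\<lambda>j. x (Suc j)) \<in> cell2"
    and x0: "tails (\<lambda>j. x (Suc j)) 0 = 0"
    using y HD(2,3)[OF x i] unfolding L2_iff by blast+
  have z2: "z \<in> cell2" unfolding z_def by (rule cell2_diff[OF y2 x2])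
  have z0: "tails z 0 = m" unfolding z_def m_def by (simp add: tails_diff[OF y2 x2] x0)
  have crit: "tails (\<lambda>j. y (Suc j) - m) k = tails (\<lambda>j. x (Suc j)) k \<longleftrightarrow> tails (\<lambda>j. z j - m) k = 0" for k
    unfolding z_def by (simp add: tails_diff[OF y2 x2] tails_diff[OF y2 cell2_const]
      tails_diff[OF cell2_diff[OF y2 x2] cell2_const] diff_eq_eq add.commute)
  have inner: "L2_inner M (y - x) v = (\<Sum>j. w j *\<^sub>R (z j * cnj (v (Suc j))))" if "v \<in> H i" for v
  proof -
    have "(\<lambda>k. (y - x) (Suc k)) \<in> cell2" using z2 by (simp add: z_def[abs_def])
    moreover have "(\<lambda>k. v (Suc k)) \<in> cell2" by (rule HD(2)[OF that i])
    ultimately show ?thesis by (simp add: L2_inner_eq z_def)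
  qed
  show ?thesis unfolding m_def[symmetric] crit
  proof
    assume proj: "is_orth_proj (L2_inner M) (H i) y x"
    show "\<forall>k\<in>J i. tails (\<lambda>j. z j - m) k = 0"
    proof
      fix k assume k: "k \<in> J i"
      define r where "r = tail_sum w k"
      define u where "u j = complex_of_real ((if k \<le> j then 1 else 0) - r)" for j
      define v where "v \<omega> = u (\<omega> - 1)" for \<omega>
      have u2: "u \<in> cell2"
        unfolding cell2_iff u_def
        by (auto simp: ell2_const intro!: ell2_bounded(1)[of _ "1 + \<bar>r\<bar>"])
      have su: "(\<lambda>j. w j *\<^sub>R (c j * u j)) sums (tails c k - r *\<^sub>R tails c 0)" if c: "c \<in> cell2" for c
      proof -
        have "(\<lambda>j. (if k \<le> j then w j *\<^sub>R c j else 0) - r *\<^sub>R (w j *\<^sub>R c j)) sums (tails c k - r *\<^sub>R tails c 0)"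
          unfolding tails_def tail_sum_0
          by (intro sums_diff sums_tail_sum sums_scaleR_right summable_sums cell2_summable c)
        moreover have "(if k \<le> j then w j *\<^sub>R c j else 0) - r *\<^sub>R (w j *\<^sub>R c j) = w j *\<^sub>R (c j * u j)" for j
          by (simp add: u_def scaleR_conv_of_real algebra_simps)
        ultimately show ?thesis by simp
      qed
      have u0: "tails u 0 = 0"
        using su[OF cell2_const[of 1]] unfolding tails_const w_tail_0
        by (simp add: tails_def tail_sum_0 sums_iff r_def)
      have uJ: "u (Suc j) = u j" if "Suc j \<notin> J i" for j
        using that k by (auto simp: u_def le_Suc_eq)
      have uK: "u j \<in> K" for j unfolding u_def by (rule K_of_real)
      have vu: "v (Suc j) = u j" for j by (simp add: v_def)
      have "v \<in> H i"
        by (rule HI[OF i], unfold vu) (rule uK u2 u0 | erule uJ)+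
      then have "0 = (\<Sum>j. w j *\<^sub>R (z j * cnj (v (Suc j))))"
        using proj inner[of v] by (simp add: is_orth_proj_def)
      also have "\<dots> = (\<Sum>j. w j *\<^sub>R (z j * u j))" by (simp add: v_def u_def)
      also have "\<dots> = tails z k - r *\<^sub>R tails z 0" using su[OF z2] by (simp add: sums_iff)
      finally show "tails (\<lambda>j. z j - m) k = 0"
        by (simp add: tails_diff[OF z2 cell2_const] tails_const z0 r_def)
    qed
  next
    assume T: "\<forall>k\<in>J i. tails (\<lambda>j. z j - m) k = 0"
    show "is_orth_proj (L2_inner M) (H i) y x" unfolding is_orth_proj_def
    proof (intro conjI x ballI)
      fix v assume v: "v \<in> H i"
      have v2: "(\<lambda>j. v (Suc j)) \<in> cell2" and v0: "tails (\<lambda>j. v (Suc j)) 0 = 0"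
        and vJ: "\<And>k. Suc k \<notin> J i \<Longrightarrow> v (Suc (Suc k)) = v (Suc k)"
        using HD[OF v i] by blast+
      define u where "u j = cnj (v (Suc j))" for j
      have u2: "u \<in> cell2" using v2 by (simp add: cell2_def u_def)
      have zm: "(\<lambda>j. z j - m) \<in> cell2" by (rule cell2_diff[OF z2 cell2_const])
      have su: "(\<lambda>j. w j *\<^sub>R u j) sums 0"
      proof -
        have "(\<lambda>j. w j *\<^sub>R v (Suc j)) sums 0"
          using summable_sums[OF cell2_summable[OF v2]] v0 by (simp add: tails_def tail_sum_0)
        then have "(\<lambda>j. cnj (w j *\<^sub>R v (Suc j))) sums cnj 0" by (simp only: sums_cnj)
        then show ?thesis by (simp add: u_def)
      qed
      have s: "summable (\<lambda>j. (w j *\<^sub>R (z j - m)) * u j)"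
        using summable_norm_cancel[OF cell2_mult_summable_norm[OF zm u2]] by simp
      have "(\<Sum>j. (w j *\<^sub>R (z j - m)) * u j) = 0"
      proof (rule suminf_mult_eq_0_if_tails_vanish[OF cell2_summable[OF zm] s])
        show "tail_sum (\<lambda>j. w j *\<^sub>R (z j - m)) 0 = 0"
          using tails_diff[OF z2 cell2_const, of m 0] z0 by (simp add: tails_0_const) (simp add: tails_def)
        show "tail_sum (\<lambda>j. w j *\<^sub>R (z j - m)) k = 0" if "k \<in> J i" for k
          using T that by (simp add: tails_def)
      qed (use vJ J_infinite[OF i] in \<open>auto simp: u_def\<close>)
      then have "(\<lambda>j. (w j *\<^sub>R (z j - m)) * u j + m * (w j *\<^sub>R u j)) sums (0 + m * 0)"
        using s by (intro sums_add sums_mult su) (simp add: sums_iff)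
      moreover have "(w j *\<^sub>R (z j - m)) * u j + m * (w j *\<^sub>R u j) = w j *\<^sub>R (z j * u j)" for j
        by (simp add: algebra_simps)
      ultimately have "(\<Sum>j. w j *\<^sub>R (z j * u j)) = 0" by (simp add: sums_iff)
      then show "L2_inner M (y - x) v = 0" by (simp add: inner[OF v] u_def)
    qed
  qed
qed

text \<open>
  The common form of the IMP and the IBAP once means are split off.
\<close>

definition tails_solvable :: bool where
  "tails_solvable \<longleftrightarrow> (\<forall>\<xi>. (\<forall>i\<in>{1..n}. \<xi> i \<in> H i) \<longrightarrow> (\<exists>\<zeta>\<in>L2_0 K M M.
     \<forall>i\<in>{1..n}. \<forall>k\<in>J i. tails (\<lambda>j. \<zeta> (Suc j)) k = tails (\<lambda>j. \<xi> i (Suc j)) k))"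

lemma IBAP_iff_tails_solvable: "IBAP (L2 K M M) (L2_inner M) n H \<longleftrightarrow> tails_solvable"
proof
  assume ib: "IBAP (L2 K M M) (L2_inner M) n H"
  show tails_solvable unfolding tails_solvable_def
  proof (intro allI impI)
    fix \<xi> assume \<xi>: "\<forall>i\<in>{1..n}. \<xi> i \<in> H i"
    then obtain y where y: "y \<in> L2 K M M" "\<And>i. i \<in> {1..n} \<Longrightarrow> is_orth_proj (L2_inner M) (H i) y (\<xi> i)"
      using ib[unfolded IBAP_def, rule_format, of \<xi>] by blast
    show "\<exists>\<zeta>\<in>L2_0 K M M. \<forall>i\<in>{1..n}. \<forall>k\<in>J i. tails (\<lambda>j. \<zeta> (Suc j)) k = tails (\<lambda>j. \<xi> i (Suc j)) k"
    proof (rule bexI[OF _ center_L2_0[OF y(1)]], intro ballI)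
      fix i k assume "i \<in> {1..n}" "k \<in> J i"
      then show "tails (\<lambda>j. y (Suc j) - tails (\<lambda>k. y (Suc k)) 0) k = tails (\<lambda>j. \<xi> i (Suc j)) k"
        using is_orth_proj_iff[OF _ y(1), of i "\<xi> i"] y(2)[of i] \<xi> by simp
    qed
  qed
next
  assume ts: tails_solvable
  show "IBAP (L2 K M M) (L2_inner M) n H" unfolding IBAP_def
  proof (intro allI impI)
    fix \<xi> assume \<xi>: "\<forall>k\<in>{1..n}. \<xi> k \<in> H k"
    then obtain \<zeta> where \<zeta>: "\<zeta> \<in> L2_0 K M M"
      "\<And>i k. i \<in> {1..n} \<Longrightarrow> k \<in> J i \<Longrightarrow> tails (\<lambda>j. \<zeta> (Suc j)) k = tails (\<lambda>j. \<xi> i (Suc j)) k"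
      using ts[unfolded tails_solvable_def, rule_format, of \<xi>] by blast
    have z: "\<zeta> \<in> L2 K M M" "tails (\<lambda>j. \<zeta> (Suc j)) 0 = 0" using \<zeta>(1) by (auto simp: L2_0_iff)
    show "\<exists>y\<in>L2 K M M. \<forall>k\<in>{1..n}. is_orth_proj (L2_inner M) (H k) y (\<xi> k)"
    proof (intro bexI[OF _ z(1)] ballI)
      fix i assume i: "i \<in> {1..n}"
      then show "is_orth_proj (L2_inner M) (H i) \<zeta> (\<xi> i)"
        using is_orth_proj_iff[OF i z(1)] \<xi> \<zeta>(2)[OF i] by (simp add: z(2))
    qed
  qed
qed

lemma set_integral_tail:
  assumes "(\<lambda>j. h (Suc j)) \<in> cell2"
  shows "(\<integral>\<omega>\<in>{Suc k..}. h \<omega> \<partial>M) = tails (\<lambda>j. h (Suc j)) k"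
proof -
  have "{Suc k..} \<in> sets M" by (auto simp: sets_M)
  from integrable_mult_indicator[OF this integrable_cell2[OF assms]]
  have "(\<integral>\<omega>\<in>{Suc k..}. h \<omega> \<partial>M) = (\<Sum>j. w j *\<^sub>R (indicator {Suc k..} (Suc j) *\<^sub>R h (Suc j)))"
    unfolding set_lebesgue_integral_def by (rule integral_M)
  also have "\<dots> = (\<Sum>j. if k \<le> j then w j *\<^sub>R h (Suc j) else 0)"
    by (rule suminf_cong) (auto simp: indicator_def)
  also have "\<dots> = tails (\<lambda>j. h (Suc j)) k"
    using sums_tail_sum[OF cell2_summable[OF assms], of k] by (simp add: tails_def sums_iff)
  finally show ?thesis .
qed

text \<open>
  The whole space and the tails \<open>{Suc k..}\<close> with \<open>k \<in> J i\<close> are unions of blocks, hence sets on which the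
  integrals have to agree. Conversely, the indicator of any set of \<open>sigma_a (A i)\<close> jumps only at points of \<open>J i\<close>.
\<close>

lemma cond_exp_iff:
  assumes i: "i \<in> {1..n}" and f: "(\<lambda>j. f (Suc j)) \<in> cell2" and g: "(\<lambda>j. g (Suc j)) \<in> cell2"
    and g_meas: "g \<in> borel_measurable (sigma_a (A i))"
  shows "(AE \<omega> in M. complex_cond_exp M (sigma_a (A i)) f \<omega> = g \<omega>) \<longleftrightarrow>
    tails (\<lambda>j. f (Suc j)) 0 = tails (\<lambda>j. g (Suc j)) 0 \<and>
    (\<forall>k\<in>J i. tails (\<lambda>j. f (Suc j)) k = tails (\<lambda>j. g (Suc j)) k)"
proof -
  interpret infinite_breakpoints "A i" by (rule breakpoints[OF i])
  have sub: "subalgebra M (sigma_a (A i))"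
    using sets.sets_into_space[of _ "sigma_a (A i)"] by (auto simp: subalgebra_def space_sigma_a space_M sets_M)
  interpret F: finite_measure_subalgebra M "sigma_a (A i)" by unfold_locales (rule sub)
  have "(AE \<omega> in M. complex_cond_exp M (sigma_a (A i)) f \<omega> = g \<omega>) \<longleftrightarrow>
      (\<forall>X\<in>sets (sigma_a (A i)). (\<integral>\<omega>\<in>X. f \<omega> \<partial>M) = (\<integral>\<omega>\<in>X. g \<omega> \<partial>M))"
    by (rule complex_cond_exp_eq_iff[OF F.sigma_finite_subalgebra_axioms integrable_cell2[OF f] integrable_cell2[OF g] g_meas])
  also have "\<dots> \<longleftrightarrow> tails (\<lambda>j. f (Suc j)) 0 = tails (\<lambda>j. g (Suc j)) 0 \<and>
    (\<forall>k\<in>J i. tails (\<lambda>j. f (Suc j)) k = tails (\<lambda>j. g (Suc j)) k)" (is "?L \<longleftrightarrow> ?R")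
  proof
    assume L: ?L
    have "{Suc k..} \<in> sets (sigma_a (A i))" if "k = 0 \<or> k \<in> J i" for k
    proof (rule sets_sigma_aI)
      show "Suc j \<in> {Suc k..} \<longleftrightarrow> j \<in> {Suc k..}" if j: "1 \<le> j" "Suc j \<notin> A i" for j
      proof (cases "k = 0")
        case False
        then have "j \<noteq> k" using j \<open>k = 0 \<or> k \<in> J i\<close> by (auto simp: J_def)
        then show ?thesis by auto
      qed (use j in auto)
    qed auto
    then show ?R using L set_integral_tail[OF f] set_integral_tail[OF g] by (metis (no_types, lifting))
  next
    assume R: ?R
    show ?L
    proof
      fix X assume X: "X \<in> sets (sigma_a (A i))"
      then have XM: "X \<in> sets M" using sub by (auto simp: subalgebra_def)
      define c where "c j = w j *\<^sub>R (f (Suc j) - g (Suc j))" for j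
      define u where "u j = (indicator X (Suc j) :: complex)" for j
      note fg = cell2_diff[OF f g]
      have si: "set_integrable M X f" "set_integrable M X g"
        unfolding set_integrable_def using integrable_mult_indicator[OF XM] integrable_cell2[OF f] integrable_cell2[OF g] by blast+
      have int: "integrable M (\<lambda>\<omega>. indicator X \<omega> *\<^sub>R (f \<omega> - g \<omega>))"
        using integrable_mult_indicator[OF XM integrable_cell2[of "\<lambda>\<omega>. f \<omega> - g \<omega>", OF fg]] .
      have cu: "w j *\<^sub>R (indicator X (Suc j) *\<^sub>R (f (Suc j) - g (Suc j))) = c j * u j" for j
        by (simp add: c_def u_def indicator_def)
      have "(\<integral>\<omega>\<in>X. f \<omega> \<partial>M) - (\<integral>\<omega>\<in>X. g \<omega> \<partial>M) = (\<integral>\<omega>\<in>X. f \<omega> - g \<omega> \<partial>M)"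
        using set_integral_diff(2)[OF si] by simp
      also have "\<dots> = (\<Sum>j. c j * u j)"
        unfolding set_lebesgue_integral_def integral_M[OF int] cu ..
      also have "\<dots> = 0"
      proof (rule suminf_mult_eq_0_if_tails_vanish)
        show "summable c" unfolding c_def by (rule cell2_summable[OF fg])
        show "summable (\<lambda>j. c j * u j)"
          using summable_norm_cancel[OF int[unfolded integrable_M_iff cu]] .
        have t: "tail_sum c k = tails (\<lambda>j. f (Suc j)) k - tails (\<lambda>j. g (Suc j)) k" for k
          using tails_diff[OF f g, of k] by (simp add: tails_def c_def[abs_def])
        show "tail_sum c 0 = 0" "\<And>k. k \<in> J i \<Longrightarrow> tail_sum c k = 0" using R by (auto simp: t)
        show "u (Suc k) = u k" if "Suc k \<notin> J i" for k
          using sigma_a_saturated[OF X, of "Suc k"] that by (simp add: u_def J_def indicator_def)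
        show "infinite (J i)" by (rule J_infinite[OF i])
      qed
      finally show "(\<integral>\<omega>\<in>X. f \<omega> \<partial>M) = (\<integral>\<omega>\<in>X. g \<omega> \<partial>M)" by simp
    qed
  qed
  finally show ?thesis .
qed

lemma random_vars_sigma_a_iff: assumes i: "i \<in> {1..n}"
  shows "g \<in> random_vars K (sigma_a (A i)) \<longleftrightarrow> g \<in> borel_measurable (sigma_a (A i)) \<and>
      (\<forall>k. g (Suc k) \<in> K)"
    and "g \<in> borel_measurable (sigma_a (A i)) \<longleftrightarrow> (\<forall>k. Suc k \<notin> J i \<longrightarrow> g (Suc (Suc k)) = g (Suc k))"
proof -
  interpret infinite_breakpoints "A i" by (rule breakpoints[OF i])
  show "g \<in> random_vars K (sigma_a (A i)) \<longleftrightarrow> g \<in> borel_measurable (sigma_a (A i)) \<and>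
      (\<forall>k. g (Suc k) \<in> K)"
    unfolding random_vars_def using ball_space[of "\<lambda>\<omega>. g \<omega> \<in> K"] by (simp add: space_sigma_a space_M)
  show "g \<in> borel_measurable (sigma_a (A i)) \<longleftrightarrow> (\<forall>k. Suc k \<notin> J i \<longrightarrow> g (Suc (Suc k)) = g (Suc k))"
    by (simp add: measurable_sigma_a_iff J_def)
qed

lemma IMP_iff_tails_solvable: "IMP K M n (\<lambda>i. sigma_a (A i)) \<longleftrightarrow> tails_solvable"
proof
  assume imp: "IMP K M n (\<lambda>i. sigma_a (A i))"
  show tails_solvable unfolding tails_solvable_def
  proof (intro allI impI)
    fix \<xi> assume \<xi>: "\<forall>i\<in>{1..n}. \<xi> i \<in> H i"
    have h: "\<xi> i \<in> random_vars K (sigma_a (A i))" "(\<lambda>j. \<xi> i (Suc j)) \<in> cell2"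
      "tails (\<lambda>j. \<xi> i (Suc j)) 0 = 0" "\<xi> i \<in> borel_measurable (sigma_a (A i))"
      if i: "i \<in> {1..n}" for i
      using HD[OF \<xi>[rule_format, OF i] i] unfolding random_vars_sigma_a_iff[OF i] by blast+
    then have "\<integral>\<omega>. \<xi> i \<omega> \<partial>M = 0" if "i \<in> {1..n}" for i using that by (simp add: integral_eq_tails)
    then obtain \<zeta> where \<zeta>: "\<zeta> \<in> random_vars K M" "integrable M (\<lambda>\<omega>. (cmod (\<zeta> \<omega>))\<^sup>2)"
      "\<And>i. i \<in> {1..n} \<Longrightarrow> AE \<omega> in M. complex_cond_exp M (sigma_a (A i)) \<zeta> \<omega> = \<xi> i \<omega>"
      using imp[unfolded IMP_def, rule_format, of \<xi>] h by (auto simp: integrable_sq_iff)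
    have z2: "(\<lambda>j. \<zeta> (Suc j)) \<in> cell2" using \<zeta>(2) by (simp add: integrable_sq_iff)
    have T: "tails (\<lambda>j. \<zeta> (Suc j)) 0 = tails (\<lambda>j. \<xi> i (Suc j)) 0 \<and>
        (\<forall>k\<in>J i. tails (\<lambda>j. \<zeta> (Suc j)) k = tails (\<lambda>j. \<xi> i (Suc j)) k)" if i: "i \<in> {1..n}" for i
      using cond_exp_iff[OF i z2 h(2)[OF i] h(4)[OF i]] \<zeta>(3)[OF i] by simp
    have "\<zeta> \<in> L2_0 K M M"
      using z2 \<zeta>(1) T[OF n_pos] h(3)[OF n_pos] by (intro L2_0I) (simp_all add: random_vars_def space_M)
    then show "\<exists>\<zeta>\<in>L2_0 K M M. \<forall>i\<in>{1..n}. \<forall>k\<in>J i. tails (\<lambda>j. \<zeta> (Suc j)) k = tails (\<lambda>j. \<xi> i (Suc j)) k"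
      using T by blast
  qed
next
  assume ts: tails_solvable
  show "IMP K M n (\<lambda>i. sigma_a (A i))" unfolding IMP_def
  proof (intro allI impI)
    fix \<xi>
    assume \<xi>: "(\<forall>k\<in>{1..n}. \<xi> k \<in> random_vars K (sigma_a (A k)) \<and> integrable M (\<lambda>\<omega>. (cmod (\<xi> k \<omega>))\<^sup>2)) \<and>
        (\<forall>i\<in>{1..n}. \<forall>j\<in>{1..n}. (\<integral>\<omega>. \<xi> i \<omega> \<partial>M) = (\<integral>\<omega>. \<xi> j \<omega> \<partial>M))"
    define c where "c = tails (\<lambda>j. \<xi> 1 (Suc j)) 0"
    have h: "(\<lambda>j. \<xi> i (Suc j)) \<in> cell2" "\<And>k. \<xi> i (Suc k) \<in> K" "\<xi> i \<in> borel_measurable (sigma_a (A i))"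
      "\<And>k. Suc k \<notin> J i \<Longrightarrow> \<xi> i (Suc (Suc k)) = \<xi> i (Suc k)"
      if i: "i \<in> {1..n}" for i
    proof -
      have "\<xi> i \<in> random_vars K (sigma_a (A i)) \<and> integrable M (\<lambda>\<omega>. (cmod (\<xi> i \<omega>))\<^sup>2)"
        using \<xi> i by blast
      then show "(\<lambda>j. \<xi> i (Suc j)) \<in> cell2" "\<And>k. \<xi> i (Suc k) \<in> K" "\<xi> i \<in> borel_measurable (sigma_a (A i))"
        "\<And>k. Suc k \<notin> J i \<Longrightarrow> \<xi> i (Suc (Suc k)) = \<xi> i (Suc k)"
        by (simp_all add: integrable_sq_iff random_vars_sigma_a_iff[OF i])
    qed
    have hc: "tails (\<lambda>j. \<xi> i (Suc j)) 0 = c" if i: "i \<in> {1..n}" for i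
      using \<xi> i n_pos integral_eq_tails[OF h(1)[OF i]] integral_eq_tails[OF h(1)[OF n_pos]]
      unfolding c_def by metis
    have cK: "c \<in> K" unfolding c_def using tails_in_K h(1,2) n_pos by blast
    have "(\<lambda>\<omega>. \<xi> i \<omega> - c) \<in> H i" if i: "i \<in> {1..n}" for i
    proof -
      have "\<xi> i \<in> L2 K M M" using h(1,2)[OF i] unfolding L2_iff by blast
      from center_L2_0[OF this] show ?thesis
        unfolding hc[OF i] H_iff[OF i] using h(4)[OF i] by simp
    qed
    then obtain \<zeta> where \<zeta>: "\<zeta> \<in> L2_0 K M M"
      "\<And>i k. i \<in> {1..n} \<Longrightarrow> k \<in> J i \<Longrightarrow> tails (\<lambda>j. \<zeta> (Suc j)) k = tails (\<lambda>j. \<xi> i (Suc j) - c) k"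
      using ts[unfolded tails_solvable_def, rule_format, of "\<lambda>i \<omega>. \<xi> i \<omega> - c"] by blast
    have z: "(\<lambda>j. \<zeta> (Suc j)) \<in> cell2" "\<And>k. \<zeta> (Suc k) \<in> K" "tails (\<lambda>j. \<zeta> (Suc j)) 0 = 0"
      using L2_0D[OF \<zeta>(1)] by blast+
    define \<eta> where "\<eta> \<omega> = \<zeta> \<omega> + c" for \<omega>
    have e2: "(\<lambda>j. \<eta> (Suc j)) \<in> cell2" unfolding \<eta>_def by (rule cell2_add[OF z(1) cell2_const])
    have et: "tails (\<lambda>j. \<eta> (Suc j)) k = tails (\<lambda>j. \<zeta> (Suc j)) k + tails (\<lambda>_. c) k" for k
      unfolding \<eta>_def by (rule tails_add[OF z(1) cell2_const])
    have eK: "\<eta> (Suc k) \<in> K" for k using z(2)[of k] cK by (auto simp: \<eta>_def K_iff)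
    show "\<exists>\<zeta>\<in>random_vars K M. integrable M (\<lambda>\<omega>. (cmod (\<zeta> \<omega>))\<^sup>2) \<and>
        (\<forall>k\<in>{1..n}. AE \<omega> in M. complex_cond_exp M (sigma_a (A k)) \<zeta> \<omega> = \<xi> k \<omega>)"
    proof (intro bexI[of _ \<eta>] conjI ballI)
      show "\<eta> \<in> random_vars K M"
        using eK ball_space[of "\<lambda>\<omega>. \<eta> \<omega> \<in> K"] by (simp add: random_vars_def measurable_M)
      show "integrable M (\<lambda>\<omega>. (cmod (\<eta> \<omega>))\<^sup>2)" using e2 by (simp add: integrable_sq_iff)
      fix i assume i: "i \<in> {1..n}"
      have "tails (\<lambda>j. \<eta> (Suc j)) k = tails (\<lambda>j. \<xi> i (Suc j)) k" if "k \<in> J i" for k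
        using \<zeta>(2)[OF i that] by (simp add: et tails_diff[OF h(1)[OF i] cell2_const])
      moreover have "tails (\<lambda>j. \<eta> (Suc j)) 0 = tails (\<lambda>j. \<xi> i (Suc j)) 0"
        by (simp add: et z(3) tails_0_const hc[OF i])
      ultimately show "AE \<omega> in M. complex_cond_exp M (sigma_a (A i)) \<eta> \<omega> = \<xi> i \<omega>"
        using cond_exp_iff[OF i e2 h(1)[OF i] h(3)[OF i]] by simp
    qed
  qed
qed

section \<open>The equivalent conditions\<close>

text \<open>
  The condition through which all statements of the theorem are compared. Real sequences suffice since
  jump parts and their adjoints act on real and imaginary parts separately.
\<close>

definition jump_parts_in_ell2 :: bool where
  "jump_parts_in_ell2 \<longleftrightarrow> (\<forall>i\<in>{1..n}. \<forall>v\<in>ell2. jump_part (J i) v \<in> ell2)"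

text \<open>
  If only one \<open>\<xi> i\<close> is nonzero, all tails of a solution are those of the adjoint of the jump part at
  \<open>\<xi> i\<close>, so the solution is this adjoint. Conversely, the sum over \<open>i\<close> of the adjoints at \<open>\<xi> i\<close> is a
  solution, since each adjoint contributes to the tails at its own jump points only.
\<close>

lemma tails_solvable_iff_jump_parts: "tails_solvable \<longleftrightarrow> jump_parts_in_ell2"
proof
  assume ts: tails_solvable
  show jump_parts_in_ell2 unfolding jump_parts_in_ell2_def
  proof (intro ballI)
    fix i v assume i: "i \<in> {1..n}" and v: "v \<in> ell2"
    show "jump_part (J i) v \<in> ell2"
    proof (rule jump_part_ell2_of_adjoint[OF zero_notin_J[OF i] _ v])
      fix x :: "nat \<Rightarrow> real"
      assume x: "x \<in> ell2" and xJ: "\<And>k. Suc k \<notin> J i \<Longrightarrow> x (Suc k) = x k" and x0: "(\<Sum>k. w k * x k) = 0"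
      define X where "X k = complex_of_real (x k)" for k
      have X2: "X \<in> cell2" using x ell2_const[of 0] by (simp add: cell2_iff X_def)
      have tX: "Re (tails X k) = tail_sum (\<lambda>k. w k * x k) k" for k using Re_tails[OF X2] by (simp add: X_def)
      have X0: "tails X 0 = 0"
        using tX[of 0] x0 Im_tails_0[OF X2, of 0] by (simp add: complex_eq_iff tail_sum_0 X_def)
      define \<xi> where "\<xi> j \<omega> = (if j = i then X (\<omega> - 1) else 0)" for j :: nat and \<omega> :: nat
      have z0: "tails (\<lambda>_. 0) k = 0" for k by (simp add: tails_const)
      have "\<xi> j \<in> H j" if "j \<in> {1..n}" for j
      proof (cases "j = i")
        case True
        have \<xi>X: "\<xi> i (Suc k) = X k" for k by (simp add: \<xi>_def)
        have XK: "X k \<in> K" for k unfolding X_def by (rule K_of_real)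
        have XJ: "X (Suc k) = X k" if "Suc k \<notin> J i" for k using xJ[OF that] by (simp add: X_def)
        have "\<xi> i \<in> H i"
          by (rule HI[OF i], unfold \<xi>X) (rule XK X2 X0 | erule XJ)+
        then show ?thesis using True by simp
      next
        case False
        then show ?thesis using K_of_real[of 0]
          by (intro HI[OF that]) (simp_all add: \<xi>_def cell2_const z0)
      qed
      then obtain \<zeta> where \<zeta>: "\<zeta> \<in> L2_0 K M M"
        "\<And>j k. j \<in> {1..n} \<Longrightarrow> k \<in> J j \<Longrightarrow> tails (\<lambda>l. \<zeta> (Suc l)) k = tails (\<lambda>l. \<xi> j (Suc l)) k"
        using ts[unfolded tails_solvable_def, rule_format, of \<xi>] by blast
      have z: "(\<lambda>j. \<zeta> (Suc j)) \<in> cell2" "tails (\<lambda>j. \<zeta> (Suc j)) 0 = 0"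
        using L2_0D[OF \<zeta>(1)] by blast+
      have mt: "masked_tail w (J i) x k = Re (tails (\<lambda>j. \<zeta> (Suc j)) k)" for k
      proof (cases "k = 0")
        case True then show ?thesis using z(2) zero_notin_J[OF i] by (simp add: masked_tail_def)
      next
        case False
        then obtain j where j: "j \<in> {1..n}" "k \<in> J j" using J_cover by blast
        show ?thesis
        proof (cases "j = i")
          case True
          then show ?thesis using \<zeta>(2)[OF j] j(2) by (simp add: masked_tail_def \<xi>_def tX)
        next
          case False
          then have "k \<notin> J i" using J_unique[OF j(1) i j(2)] by blast
          then show ?thesis using \<zeta>(2)[OF j] False by (simp add: masked_tail_def \<xi>_def z0)
        qed
      qed
      have "jump_adjoint w (J i) x k = Re (\<zeta> (Suc k))" for k
      proof -
        have "masked_tail w (J i) x k - masked_tail w (J i) x (Suc k) = Re (w k *\<^sub>R \<zeta> (Suc k))"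
          unfolding mt tails_def using tail_sum_step[OF cell2_summable[OF z(1)], of k] by simp
        then show ?thesis using w_pos[of k] by (simp add: jump_adjoint_def)
      qed
      then have "jump_adjoint w (J i) x = (\<lambda>k. Re (\<zeta> (Suc k)))" by blast
      then show "jump_adjoint w (J i) x \<in> ell2" using z(1) by (simp add: cell2_iff)
    qed
  qed
next
  assume jp: jump_parts_in_ell2
  show tails_solvable unfolding tails_solvable_def
  proof (intro allI impI)
    fix \<xi> assume \<xi>: "\<forall>i\<in>{1..n}. \<xi> i \<in> H i"
    define x where "x i j = \<xi> i (Suc j)" for i j
    have x2: "x i \<in> cell2" and xK: "\<And>k. x i k \<in> K" if "i \<in> {1..n}" for i
      using HD[OF \<xi>[rule_format, OF that] that] by (simp_all add: x_def[abs_def])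
    define Z where "Z k = (\<Sum>i\<in>{1..n}. jump_adjoint w (J i) (x i) k)" for k
    have a2: "jump_adjoint w (J i) (x i) \<in> cell2" if "i \<in> {1..n}" for i
      using cell2_jump_adjoint[OF zero_notin_J[OF that] _ x2[OF that]] jp that
      by (simp add: jump_parts_in_ell2_def)
    have Z2: "Z \<in> cell2" unfolding Z_def by (rule cell2_sum) (use a2 in auto)
    have tZ: "tails Z k = (\<Sum>i\<in>{1..n}. if k \<in> J i then tails (x i) k else 0)" for k
    proof -
      have "tails Z k = (\<Sum>i\<in>{1..n}. tails (jump_adjoint w (J i) (x i)) k)"
        unfolding Z_def by (rule tails_sum[OF _ a2]) simp
      also have "\<dots> = (\<Sum>i\<in>{1..n}. if k \<in> J i then tails (x i) k else 0)"
        by (rule sum.cong[OF refl], rule tails_jump_adjoint[OF zero_notin_J x2])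
      finally show ?thesis .
    qed
    have ZK: "Z k \<in> K" for k
    proof (cases "K = UNIV")
      case False
      have "jump_adjoint w (J i) (\<lambda>k. Im (x i k)) k = 0" if "i \<in> {1..n}" for i
        using xK[OF that] False by (simp add: K_iff jump_adjoint_def masked_tail_def tail_sum_def)
      then have "Im (Z k) = 0" unfolding Z_def by (simp add: Re_Im_jump_adjoint x2)
      then show ?thesis by (simp add: K_iff)
    qed simp
    define \<zeta> where "\<zeta> \<omega> = Z (\<omega> - 1)" for \<omega>
    have "tails Z 0 = 0" unfolding tZ using zero_notin_J by (intro sum.neutral) auto
    then have "\<zeta> \<in> L2_0 K M M" using Z2 ZK by (intro L2_0I) (simp_all add: \<zeta>_def)
    moreover have "tails (\<lambda>j. \<zeta> (Suc j)) k = tails (\<lambda>j. \<xi> i (Suc j)) k" if i: "i \<in> {1..n}" and k: "k \<in> J i" for i k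
    proof -
      have "tails Z k = (\<Sum>j\<in>{1..n}. if j = i then tails (x i) k else 0)"
        unfolding tZ by (rule sum.cong[OF refl]) (simp add: mem_J_iff[OF i _ k])
      then show ?thesis using i by (simp add: \<zeta>_def x_def[abs_def])
    qed
    ultimately show "\<exists>\<zeta>\<in>L2_0 K M M. \<forall>i\<in>{1..n}. \<forall>k\<in>J i. tails (\<lambda>j. \<zeta> (Suc j)) k = tails (\<lambda>j. \<xi> i (Suc j)) k"
      by blast
  qed
qed

lemma sum_jump_parts:
  fixes v :: "nat \<Rightarrow> 'b::ab_group_add"
  shows "(\<Sum>i\<in>{1..n}. jump_part (J i) v k) = v k - v 0"
proof (induction k)
  case (Suc k)
  obtain i where i: "i \<in> {1..n}" "Suc k \<in> J i" using J_cover[of "Suc k"] by auto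
  have "(\<Sum>j\<in>{1..n}. if Suc k \<in> J j then v (Suc k) - v k else 0) = (\<Sum>j\<in>{1..n}. if j = i then v (Suc k) - v k else 0)"
    by (rule sum.cong[OF refl]) (simp add: mem_J_iff[OF i(1) _ i(2)])
  then show ?case using Suc i(1) by (simp add: jump_part_Suc sum.distrib)
qed simp

text \<open>
  The jump parts add up to \<open>f\<close> minus its value at the first point; centring them turns this constant into
  the mean of \<open>f\<close>, which is zero. The value at the point \<open>0\<close> outside the space is arbitrary and is
  assigned to the first summand.
\<close>

lemma mem_sum_of_subspaces:
  assumes f: "f \<in> L2_0 K M M"
    and jp: "\<And>i. i \<in> {1..n} \<Longrightarrow> jump_part (J i) (\<lambda>k. f (Suc k)) \<in> cell2"
  shows "f \<in> sum_of_subspaces n H"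
proof -
  let ?v = "\<lambda>k. f (Suc k)"
  have v: "?v \<in> cell2" "\<And>k. f (Suc k) \<in> K" "tails ?v 0 = 0" using L2_0D[OF f] by blast+
  define m where "m i = tails (jump_part (J i) ?v) 0" for i
  define x where "x i \<omega> = (if \<omega> = 0 then if i = 1 then f 0 else 0 else jump_part (J i) ?v (\<omega> - 1) - m i)" for i \<omega>
  have QK: "jump_part (J i) ?v k \<in> K" for i k
  proof (cases "K = UNIV")
    case False
    then have v0: "Im (f (Suc j)) = 0" for j using v(2)[of j] unfolding K_iff by blast
    have "Im (jump_part (J i) u k) = jump_part (J i) (\<lambda>k. Im (u k)) k" for u :: "nat \<Rightarrow> complex"
      by (simp add: jump_part_def)
    from this[of ?v] have "Im (jump_part (J i) ?v k) = jump_part (J i) (\<lambda>_. 0) k" by (simp only: v0)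
    then show ?thesis unfolding K_iff by (simp add: jump_part_def[of "J i" "\<lambda>_. 0"])
  qed simp
  have xH: "x i \<in> H i" if i: "i \<in> {1..n}" for i
  proof -
    have "m i \<in> K" unfolding m_def by (rule tails_in_K[OF jp[OF i] QK])
    have xS: "x i (Suc k) = jump_part (J i) ?v k - m i" for k by (simp add: x_def)
    show ?thesis
    proof (rule HI[OF i], unfold xS)
      show "jump_part (J i) ?v k - m i \<in> K" for k by (rule K_diff[OF QK \<open>m i \<in> K\<close>])
      show "(\<lambda>k. jump_part (J i) ?v k - m i) \<in> cell2" by (rule cell2_diff[OF jp[OF i] cell2_const])
      show "tails (\<lambda>k. jump_part (J i) ?v k - m i) 0 = 0"
        by (simp only: tails_diff[OF jp[OF i] cell2_const] tails_0_const m_def diff_self)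
    qed (simp add: jump_part_Suc)
  qed
  have msum: "(\<Sum>i\<in>{1..n}. m i) = - f (Suc 0)"
  proof -
    have "(\<Sum>i\<in>{1..n}. m i) = tails (\<lambda>k. \<Sum>i\<in>{1..n}. jump_part (J i) ?v k) 0"
      unfolding m_def by (rule tails_sum[symmetric]) (use jp in auto)
    also have "\<dots> = tails (\<lambda>k. ?v k - f (Suc 0)) 0" by (simp only: sum_jump_parts)
    also have "\<dots> = - f (Suc 0)" by (simp add: tails_diff[OF v(1) cell2_const] v(3) tails_0_const)
    finally show ?thesis .
  qed
  have "f \<omega> = (\<Sum>k=1..n. x k \<omega>)" for \<omega>
  proof (cases \<omega>)
    case 0
    then have "(\<Sum>k=1..n. x k \<omega>) = (\<Sum>k=1..n. if k = 1 then f 0 else 0)" by (simp add: x_def)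
    then show ?thesis using 0 n_pos by simp
  next
    case (Suc k)
    then have "(\<Sum>k=1..n. x k \<omega>) = (\<Sum>i\<in>{1..n}. jump_part (J i) ?v k) - (\<Sum>i\<in>{1..n}. m i)"
      by (simp add: x_def sum_subtractf)
    then show ?thesis unfolding sum_jump_parts msum using Suc by simp
  qed
  then have "f = (\<lambda>\<omega>. \<Sum>k=1..n. x k \<omega>)" by blast
  then show ?thesis unfolding sum_of_subspaces_def using xH by blast
qed

lemma sum_of_subspaces_subset: "sum_of_subspaces n H \<subseteq> L2_0 K M M"
proof
  fix f assume "f \<in> sum_of_subspaces n H"
  then obtain x where f: "f = (\<lambda>\<omega>. \<Sum>k=1..n. x k \<omega>)" and x: "\<And>k. k \<in> {1..n} \<Longrightarrow> x k \<in> H k"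
    unfolding sum_of_subspaces_def by blast
  have h: "(\<lambda>j. x k (Suc j)) \<in> cell2" "\<And>j. x k (Suc j) \<in> K" "tails (\<lambda>j. x k (Suc j)) 0 = 0" if "k \<in> {1..n}" for k
    using HD[OF x[OF that] that] by blast+
  have "f (Suc j) \<in> K" for j
  proof (cases "K = UNIV")
    case False
    then have "Im (x k (Suc j)) = 0" if "k \<in> {1..n}" for k using h(2)[OF that, of j] unfolding K_iff by blast
    then show ?thesis unfolding f K_iff Im_sum by (simp add: sum.neutral)
  qed simp
  moreover have "(\<lambda>j. f (Suc j)) \<in> cell2" unfolding f by (rule cell2_sum) (use h in auto)
  moreover have "tails (\<lambda>j. f (Suc j)) 0 = 0" unfolding f using h by (subst tails_sum) auto
  ultimately show "f \<in> L2_0 K M M" by (rule L2_0I)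
qed

text \<open>
  The jump at a point of \<open>J i\<close> of a sum of elements of the \<open>H j\<close> is the jump of the \<open>i\<close>-th summand alone.
  So this summand is the jump part, up to a constant.
\<close>

lemma sum_eq_L2_0_iff_jump_parts: "sum_of_subspaces n H = L2_0 K M M \<longleftrightarrow> jump_parts_in_ell2"
proof
  assume jp: jump_parts_in_ell2
  have "f \<in> sum_of_subspaces n H" if f: "f \<in> L2_0 K M M" for f
  proof (rule mem_sum_of_subspaces[OF f])
    fix i assume "i \<in> {1..n}"
    then show "jump_part (J i) (\<lambda>k. f (Suc k)) \<in> cell2"
      using jp by (intro cell2_jump_part[OF _ L2_0D(2)[OF f]]) (auto simp: jump_parts_in_ell2_def)
  qed
  then show "sum_of_subspaces n H = L2_0 K M M" using sum_of_subspaces_subset by blast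
next
  assume eq: "sum_of_subspaces n H = L2_0 K M M"
  show jump_parts_in_ell2 unfolding jump_parts_in_ell2_def
  proof (intro ballI)
    fix i v assume i: "i \<in> {1..n}" and v: "v \<in> ell2"
    define g where "g \<omega> = complex_of_real (v (\<omega> - 1))" for \<omega> :: nat
    define f where "f \<omega> = g \<omega> - tails (\<lambda>k. g (Suc k)) 0" for \<omega>
    have "g \<in> L2 K M M" using v ell2_const[of 0] by (simp add: L2_iff K_of_real g_def cell2_iff)
    then have "f \<in> sum_of_subspaces n H" unfolding eq f_def by (rule center_L2_0)
    then obtain x where f: "f = (\<lambda>\<omega>. \<Sum>k=1..n. x k \<omega>)" and x: "\<And>k. k \<in> {1..n} \<Longrightarrow> x k \<in> H k"
      unfolding sum_of_subspaces_def by blast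
    have xJ: "x j (Suc (Suc k)) = x j (Suc k)" if "j \<in> {1..n}" "Suc k \<notin> J j" for j k
      using HD(4)[OF x[OF that(1)] that(1)] that(2) by blast
    have jump: "x i (Suc (Suc k)) - x i (Suc k) = (if Suc k \<in> J i then complex_of_real (v (Suc k) - v k) else 0)" for k
    proof (cases "Suc k \<in> J i")
      case True
      have "complex_of_real (v (Suc k) - v k) = f (Suc (Suc k)) - f (Suc k)" by (simp add: f_def g_def)
      also have "\<dots> = (\<Sum>j=1..n. x j (Suc (Suc k)) - x j (Suc k))" by (simp add: f sum_subtractf)
      also have "\<dots> = (\<Sum>j=1..n. if j = i then x i (Suc (Suc k)) - x i (Suc k) else 0)"
      proof (rule sum.cong[OF refl])
        fix j assume j: "j \<in> {1..n}"
        show "x j (Suc (Suc k)) - x j (Suc k) = (if j = i then x i (Suc (Suc k)) - x i (Suc k) else 0)"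
          using xJ[OF j, of k] by (simp add: mem_J_iff[OF i j True])
      qed
      also have "\<dots> = x i (Suc (Suc k)) - x i (Suc k)" using i by simp
      finally show ?thesis using True by simp
    qed (simp add: xJ[OF i])
    have "complex_of_real (jump_part (J i) v k) = x i (Suc k) - x i (Suc 0)" for k
    proof (induction k)
      case (Suc k) then show ?case using jump[of k] by (auto simp: jump_part_Suc algebra_simps)
    qed simp
    then have "jump_part (J i) v k = Re (x i (Suc k)) - Re (x i (Suc 0))" for k
      by (metis Re_complex_of_real minus_complex.sel(1))
    then have "jump_part (J i) v = (\<lambda>k. Re (x i (Suc k)) - Re (x i (Suc 0)))" by blast
    then show "jump_part (J i) v \<in> ell2"
      using HD(2)[OF x[OF i] i] unfolding cell2_iff by (simp add: ell2_diff(1)[OF _ ell2_const])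
  qed
qed

lemma L2_0_closed: "closed_in_L2 K M (L2_0 K M M)"
  unfolding closed_in_L2_def
proof (intro conjI allI impI)
  show "L2_0 K M M \<subseteq> L2 K M M" by (auto simp: L2_0_iff)
  fix f :: "nat \<Rightarrow> nat \<Rightarrow> complex" and g
  assume as: "(\<forall>j. f j \<in> L2_0 K M M) \<and> g \<in> L2 K M M \<and> (\<lambda>j. L2_norm M (\<lambda>\<omega>. f j \<omega> - g \<omega>)) \<longlonglongrightarrow> 0"
  have f: "(\<lambda>k. f j (Suc k)) \<in> cell2" "tails (\<lambda>k. f j (Suc k)) 0 = 0" for j
    using L2_0D[of "f j"] as by blast+
  have g: "(\<lambda>k. g (Suc k)) \<in> cell2" using as unfolding L2_iff by blast
  have "norm (tails (\<lambda>k. g (Suc k)) 0) \<le> L2_norm M (\<lambda>\<omega>. f j \<omega> - g \<omega>)" for j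
  proof -
    note d = cell2_diff[OF f(1) g, of j]
    have "norm (tails (\<lambda>k. f j (Suc k) - g (Suc k)) 0) \<le> nrm (\<lambda>k. cmod (f j (Suc k) - g (Suc k)))"
      using cell2_norm_suminf_le[OF d] by (simp add: tails_def tail_sum_0)
    then show ?thesis using L2_norm_eq[of "\<lambda>\<omega>. f j \<omega> - g \<omega>", OF d] by (simp add: tails_diff[OF f(1) g] f(2))
  qed
  then have "norm (tails (\<lambda>k. g (Suc k)) 0) \<le> 0" using as by (intro LIMSEQ_le_const) auto
  then show "g \<in> L2_0 K M M" using as by (simp add: L2_0_iff)
qed

text \<open>
  Density: truncate \<open>f\<close> after the point \<open>N\<close> and subtract the mean. The result \<open>F N\<close> has jump parts that are
  constant from some index on, hence lies in the sum. With \<open>h N\<close> for the part of \<open>f\<close> that was cut off,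
  the mean of the truncation is minus that of \<open>h N\<close>, so the distance to \<open>f\<close> is at most twice the norm of
  \<open>h N\<close>.
\<close>

lemma sum_eq_L2_0_if_closed:
  assumes cl: "closed_in_L2 K M (sum_of_subspaces n H)"
  shows "sum_of_subspaces n H = L2_0 K M M"
proof
  show "L2_0 K M M \<subseteq> sum_of_subspaces n H"
  proof
    fix f assume f: "f \<in> L2_0 K M M"
    have f2: "(\<lambda>k. f (Suc k)) \<in> cell2" "\<And>k. f (Suc k) \<in> K" "tails (\<lambda>k. f (Suc k)) 0 = 0"
      using L2_0D[OF f] by blast+
    define t where "t N k = (if k < N then f (Suc k) else 0)" for N k
    define m where "m N = tails (t N) 0" for N
    define h where "h N k = (if k < N then 0 else f (Suc k))" for N k
    define F where "F N \<omega> = (if \<omega> \<le> N then f \<omega> else 0) - m N" for N \<omega>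
    have FSuc: "F N (Suc k) = t N k - m N" for N k by (simp add: F_def t_def Suc_le_eq)
    have t2: "t N \<in> cell2" for N
      unfolding cell2_iff using ell2_of_finite_support(1)[of N "\<lambda>k. Re (t N k)"]
        ell2_of_finite_support(1)[of N "\<lambda>k. Im (t N k)"] by (simp add: t_def)
    have h2: "h N \<in> cell2" for N
    proof -
      have "h N = (\<lambda>k. f (Suc k) - t N k)" by (auto simp: h_def t_def)
      then show ?thesis using cell2_diff[OF f2(1) t2[of N]] by simp
    qed
    have fs: "F N \<in> sum_of_subspaces n H" for N
    proof (rule mem_sum_of_subspaces)
      have "t N k \<in> K" for k using f2(2)[of k] K_of_real[of 0] by (simp add: t_def)
      moreover have tS: "(if Suc k \<le> N then f (Suc k) else 0) = t N k" for k by (simp add: t_def Suc_le_eq)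
      ultimately have "(\<lambda>\<omega>. if \<omega> \<le> N then f \<omega> else 0) \<in> L2 K M M"
        unfolding L2_iff tS using t2[of N] by simp
      from center_L2_0[OF this] show "F N \<in> L2_0 K M M"
        unfolding tS F_def[abs_def] m_def .
      fix i
      have "jump_part (J i) (\<lambda>k. F N (Suc k)) = jump_part (J i) (t N)"
        by (simp add: jump_part_def FSuc fun_eq_iff)
      moreover have "jump_part (J i) (t N) \<in> cell2"
      proof -
        have "Re (jump_part (J i) (t N) k) = jump_part (J i) (\<lambda>k. Re (t N k)) k"
          "Im (jump_part (J i) (t N) k) = jump_part (J i) (\<lambda>k. Im (t N k)) k" for k
          by (simp_all add: jump_part_def)
        then show ?thesis unfolding cell2_iff
          using jump_part_ell2_of_finite_support[of N "\<lambda>k. Re (t N k)" "J i"]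
            jump_part_ell2_of_finite_support[of N "\<lambda>k. Im (t N k)" "J i"] by (simp add: t_def)
      qed
      ultimately show "jump_part (J i) (\<lambda>k. F N (Suc k)) \<in> cell2" by simp
    qed
    have bound: "L2_norm M (\<lambda>\<omega>. F N \<omega> - f \<omega>) \<le> 2 * nrm (\<lambda>k. cmod (h N k))" for N
    proof -
      have e: "F N (Suc k) - f (Suc k) = - h N k - m N" for k by (simp add: FSuc t_def h_def)
      have d: "(\<lambda>k. F N (Suc k) - f (Suc k)) \<in> cell2"
        unfolding FSuc by (intro cell2_diff t2 cell2_const f2(1))
      have "tails (h N) 0 = - m N"
      proof -
        have "h N = (\<lambda>k. f (Suc k) - t N k)" by (auto simp: h_def t_def)
        then show ?thesis using tails_diff[OF f2(1) t2[of N], of 0] by (simp add: f2(3) m_def)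
      qed
      then have mb: "cmod (m N) \<le> nrm (\<lambda>k. cmod (h N k))"
        using cell2_norm_suminf_le[OF h2[of N]] by (simp add: tails_def tail_sum_0)
      have hl: "(\<lambda>k. cmod (h N k)) \<in> ell2" using h2 by (simp add: cell2_def)
      have "L2_norm M (\<lambda>\<omega>. F N \<omega> - f \<omega>) = nrm (\<lambda>k. cmod (F N (Suc k) - f (Suc k)))"
        by (rule L2_norm_eq[of "\<lambda>\<omega>. F N \<omega> - f \<omega>", OF d])
      also have "\<dots> \<le> nrm (\<lambda>k. cmod (h N k) + cmod (m N))"
      proof (rule power2_le_imp_le[OF _ nrm_nonneg])
        have s: "summable (\<lambda>k. w k * (cmod (F N (Suc k) - f (Suc k)))\<^sup>2)" using d by (simp add: cell2_def ell2_def)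
        have s': "(\<lambda>k. cmod (h N k) + cmod (m N)) \<in> ell2" by (rule ell2_add(1)[OF hl ell2_const])
        have "cmod (F N (Suc k) - f (Suc k)) \<le> cmod (h N k) + cmod (m N)" for k
          unfolding e using norm_triangle_ineq4[of "- h N k" "m N"] by simp
        then have "(\<Sum>k. w k * (cmod (F N (Suc k) - f (Suc k)))\<^sup>2) \<le> (\<Sum>k. w k * (cmod (h N k) + cmod (m N))\<^sup>2)"
          using s s' by (intro suminf_le mult_left_mono power_mono w_nonneg) (auto simp: ell2_def)
        then show "(nrm (\<lambda>k. cmod (F N (Suc k) - f (Suc k))))\<^sup>2 \<le> (nrm (\<lambda>k. cmod (h N k) + cmod (m N)))\<^sup>2"
          using d s' by (simp add: nrm_sq cell2_def)
      qed
      also have "\<dots> \<le> nrm (\<lambda>k. cmod (h N k)) + nrm (\<lambda>_. cmod (m N))" by (rule ell2_add(2)[OF hl ell2_const])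
      also have "nrm (\<lambda>_. cmod (m N)) \<le> cmod (m N)" by (rule ell2_bounded(2)) simp
      finally show ?thesis using mb by linarith
    qed
    have nh: "(nrm (\<lambda>k. cmod (h N k)))\<^sup>2 = tail_sum (\<lambda>k. w k * (cmod (f (Suc k)))\<^sup>2) N" for N
    proof -
      have s: "summable (\<lambda>k. w k * (cmod (f (Suc k)))\<^sup>2)" using f2(1) by (simp add: cell2_def ell2_def)
      have "(\<lambda>k. w k * (cmod (h N k))\<^sup>2) = (\<lambda>k. if N \<le> k then w k * (cmod (f (Suc k)))\<^sup>2 else 0)"
        by (auto simp: h_def)
      then show ?thesis using h2[of N] sums_tail_sum[OF s, of N] by (simp add: nrm_sq cell2_def sums_iff)
    qed
    have "(\<lambda>N. sqrt ((nrm (\<lambda>k. cmod (h N k)))\<^sup>2)) \<longlonglongrightarrow> sqrt 0"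
      unfolding nh using f2(1) by (intro tendsto_real_sqrt tail_sum_tendsto_0) (simp add: cell2_def ell2_def)
    then have "(\<lambda>N. 2 * nrm (\<lambda>k. cmod (h N k))) \<longlonglongrightarrow> 0"
      using tendsto_mult_right_zero by (fastforce simp: nrm_nonneg)
    then have "(\<lambda>N. L2_norm M (\<lambda>\<omega>. F N \<omega> - f \<omega>)) \<longlonglongrightarrow> 0"
      by (rule Lim_null_comparison[rotated]) (use bound in \<open>simp add: L2_norm_def\<close>)
    then show "f \<in> sum_of_subspaces n H"
      using cl fs f unfolding closed_in_L2_def L2_0_iff by blast
  qed
qed (rule sum_of_subspaces_subset)

lemma closed_sum_iff: "closed_in_L2 K M (sum_of_subspaces n H) \<longleftrightarrow> sum_of_subspaces n H = L2_0 K M M"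
  using sum_eq_L2_0_if_closed L2_0_closed by auto

lemma tail_sum_w_pos: "0 < tail_sum w k"
proof -
  have "summable (\<lambda>j. w (j + k))" using w_summable summable_iff_shift[of w k] by simp
  then show ?thesis unfolding tail_sum_def by (rule suminf_pos) (rule w_pos)
qed

section \<open>Geometric decay of the tails\<close>

lemma jump_parts_if_tail_ratio:
  assumes "(SUP k. tail_sum w (Suc k) / tail_sum w k) < 1"
  shows jump_parts_in_ell2
proof -
  let ?q = "\<lambda>k. tail_sum w (Suc k) / tail_sum w k"
  have "?q k \<le> 1" for k
    using tail_sum_step[OF w_summable, of k] w_pos[of k] tail_sum_w_pos[of k] by (simp add: field_simps)
  then have "bdd_above (range ?q)" by (intro bdd_aboveI2)
  then have le: "?q k \<le> (SUP k. ?q k)" for k by (intro cSUP_upper) auto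
  have "tail_sum w (Suc k) \<le> (SUP k. ?q k) * tail_sum w k" for k
    using le[of k] tail_sum_w_pos[of k] by (simp add: pos_divide_le_eq)
  then show ?thesis unfolding jump_parts_in_ell2_def
    using jump_part_ell2_of_geometric_tails[OF assms] by blast
qed

text \<open>
  From \<open>k0\<close> on, the uniform bound of the jump parts keeps the ratios away from \<open>1\<close>; each of the finitely
  many earlier ratios is less than \<open>1\<close> because all masses are positive.
\<close>

lemma tail_ratio_if_jump_parts:
  assumes jp: jump_parts_in_ell2
    and alt: "\<And>k. k0 \<le> k \<Longrightarrow> \<exists>i\<in>{1..n}. \<exists>j\<in>{1..n}. i \<noteq> j \<and> k \<in> J i \<and> Suc k \<in> J j"
  shows "(SUP k. tail_sum w (Suc k) / tail_sum w k) < 1"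
proof -
  let ?q = "\<lambda>k. tail_sum w (Suc k) / tail_sum w k"
  have step: "w k = tail_sum w k - tail_sum w (Suc k)" for k by (rule tail_sum_step[OF w_summable])
  have "\<exists>C\<ge>0. \<forall>v\<in>ell2. nrm (jump_part (J i) v) \<le> C * nrm v" if "i \<in> {1..n}" for i
    using jump_part_bounded[of "J i"] jp that by (simp add: jump_parts_in_ell2_def)
  then have "\<forall>i. \<exists>C. i \<in> {1..n} \<longrightarrow> 0 \<le> C \<and> (\<forall>v\<in>ell2. nrm (jump_part (J i) v) \<le> C * nrm v)" by blast
  from choice[OF this] obtain C where C: "\<And>i. i \<in> {1..n} \<Longrightarrow> 0 \<le> C i"
    "\<And>i v. i \<in> {1..n} \<Longrightarrow> v \<in> ell2 \<Longrightarrow> nrm (jump_part (J i) v) \<le> C i * nrm v" by blast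
  define D where "D = 1 + (\<Sum>i\<in>{1..n}. (C i)\<^sup>2)"
  have D: "1 \<le> D" by (simp add: D_def sum_nonneg)
  have late: "?q k \<le> 1 - 1 / D" if k: "k0 \<le> k" for k
  proof -
    obtain i j where ij: "i \<in> {1..n}" "j \<in> {1..n}" "i \<noteq> j" "k \<in> J i" "Suc k \<in> J j" using alt[OF k] by blast
    have "Suc k \<notin> J i" using J_unique[of i j "Suc k"] ij by blast
    moreover have "0 < k" using zero_notin_J[OF ij(1)] ij(4) by (cases k) auto
    ultimately have "tail_sum w k \<le> (C i)\<^sup>2 * w k"
      using jp ij C by (intro tail_ratio_of_jump_part_bounded[of "C i" "J i"]) (auto simp: jump_parts_in_ell2_def)
    also have "\<dots> \<le> D * w k"
    proof (rule mult_right_mono[OF _ w_nonneg])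
      have "(C i)\<^sup>2 \<le> (\<Sum>i\<in>{1..n}. (C i)\<^sup>2)" by (rule member_le_sum[OF ij(1)]) auto
      then show "(C i)\<^sup>2 \<le> D" by (simp add: D_def)
    qed
    finally have "tail_sum w k / D \<le> w k" using D by (simp add: divide_le_eq mult.commute)
    then have "tail_sum w (Suc k) \<le> (1 - 1 / D) * tail_sum w k" using step[of k] by (simp add: algebra_simps)
    then show ?thesis using tail_sum_w_pos[of k] by (simp add: pos_divide_le_eq)
  qed
  define \<theta> where "\<theta> = Max (insert (1 - 1 / D) (?q ` {..<k0}))"
  have "?q k < 1" for k using step[of k] w_pos[of k] tail_sum_w_pos[of k] by (simp add: field_simps)
  then have "\<theta> < 1" unfolding \<theta>_def using D by (subst Max_less_iff) auto
  moreover have "(SUP k. ?q k) \<le> \<theta>"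
  proof (rule cSUP_least)
    fix k
    show "?q k \<le> \<theta>"
    proof (cases "k0 \<le> k")
      case True
      have "1 - 1 / D \<le> \<theta>" unfolding \<theta>_def by (rule Max_ge) auto
      then show ?thesis using late[OF True] by linarith
    next
      case False
      then show ?thesis unfolding \<theta>_def by (intro Max_ge) auto
    qed
  qed simp
  ultimately show ?thesis by linarith
qed

end

section \<open>The theorem\<close>

theorem theorem5p2:
  fixes K :: "complex set" and M :: "nat measure" and p r :: "nat \<Rightarrow> real"
    and n :: nat and A :: "nat \<Rightarrow> nat set"
  assumes K: "K = \<real> \<or> K = UNIV"
    and M: "prob_space M" "space M = {1..}" "sets M = Pow {1..}"
    and p: "\<And>k. k \<ge> 1 \<Longrightarrow> measure M {k} = p k" "\<And>k. k \<ge> 1 \<Longrightarrow> p k > 0"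
    and A: "(\<Union>i\<in>{1..n}. A i) = {1..} - {1}" "disjoint_family_on A {1..n}"
      "\<And>i. i \<in> {1..n} \<Longrightarrow> infinite (A i)"
    and r: "\<And>k. k \<ge> 1 \<Longrightarrow> r k = (\<Sum>j. p (k + j))"
  shows
    "(IMP K M n (\<lambda>i. sigma_a (A i)) \<longleftrightarrow>
        IBAP (L2 K M M) (L2_inner M) n (\<lambda>i. L2_0 K M (sigma_a (A i)))) \<and>
     (IBAP (L2 K M M) (L2_inner M) n (\<lambda>i. L2_0 K M (sigma_a (A i))) \<longleftrightarrow>
        closed_in_L2 K M (sum_of_subspaces n (\<lambda>i. L2_0 K M (sigma_a (A i))))) \<and>
     (closed_in_L2 K M (sum_of_subspaces n (\<lambda>i. L2_0 K M (sigma_a (A i)))) \<longleftrightarrow>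
        sum_of_subspaces n (\<lambda>i. L2_0 K M (sigma_a (A i))) = L2_0 K M M) \<and>
     ((SUP k\<in>{1..}. r (k + 1) / r k) < 1 \<longrightarrow> IMP K M n (\<lambda>i. sigma_a (A i))) \<and>
     ((\<exists>k0\<ge>2. \<forall>k\<ge>k0. \<exists>i\<in>{1..n}. \<exists>j\<in>{1..n}. i \<noteq> j \<and> k \<in> A i \<and> k + 1 \<in> A j) \<longrightarrow>
        IMP K M n (\<lambda>i. sigma_a (A i)) \<longrightarrow> (SUP k\<in>{1..}. r (k + 1) / r k) < 1)"
proof -
  interpret prob_space M by (rule M(1))
  interpret partitioned_naturals M K n A
    by unfold_locales (use K M p A in auto)
  have r_eq: "r (Suc k) = tail_sum w k" for k
    using r[of "Suc k"] p(1) by (simp add: tail_sum_def w_def add.commute)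
  have sup_eq: "(SUP k\<in>{1..}. r (k + 1) / r k) = (SUP k. tail_sum w (Suc k) / tail_sum w k)"
    unfolding range_Suc_eq[symmetric] image_image by (simp add: r_eq)
  have "(SUP k\<in>{1..}. r (k + 1) / r k) < 1"
    if k0: "\<forall>k\<ge>k0. \<exists>i\<in>{1..n}. \<exists>j\<in>{1..n}. i \<noteq> j \<and> k \<in> A i \<and> k + 1 \<in> A j" and jp: jump_parts_in_ell2 for k0
    unfolding sup_eq
  proof (rule tail_ratio_if_jump_parts[OF jp, of k0])
    fix k assume "k0 \<le> k"
    then show "\<exists>i\<in>{1..n}. \<exists>j\<in>{1..n}. i \<noteq> j \<and> k \<in> J i \<and> Suc k \<in> J j"
      using k0[rule_format, of "Suc k"] by (simp add: J_def)
  qed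
  then show ?thesis
    using IMP_iff_tails_solvable IBAP_iff_tails_solvable tails_solvable_iff_jump_parts
      sum_eq_L2_0_iff_jump_parts closed_sum_iff jump_parts_if_tail_ratio sup_eq by auto
qed

end
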